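(* Let $G$ be a graph with maximum degree $\Delta(G)$. If $\mathrm{mad}(G)<12/5$, then $$\tau_2(G)\le \max\left\{7,\ \left\lceil\sqrt{2\Delta(G)+0.25}+2.5\right\rceil\right\}.$$ Further, if $G$ is planar with girth at least $12$ and $\Delta(G)\ge 7$, then $$\tau_2(G)=\left\lceil\sqrt{2\Delta(G)+0.25}+2.5\right\rceil.$$
   Context: All graphs are finite and simple. $\mathrm{mad}(G)$, the maximum average degree of $G$, is the maximum of the average degree $2|E(H)|/|V(H)|$ over all nonempty subgraphs $H$ of $G$. The girth of a graph is the length of its shortest cycle ($\infty$ if it is acyclic). $[k]=\{1,\dots,k\}$ and $\binom{[k]}{t}$ is the collection of all $t$-element subsets of $[k]$. $d(v,w)$ is the distance between $v$ and $w$ (with $d(v,w)=\infty$ if they lie in different components). For a graph $G$ and positive integers $t,k$, a $t$-tone $k$-coloring of $G$ is a function $f:V(G)\to\binom{[k]}{t}$ such that $|f(v)\cap f(w)|<d(v,w)$ for all distinct $v,w\in V(G)$. The $t$-tone chromatic number $\tau_t(G)$ is the minimum $k$ such that $G$ has a $t$-tone $k$-coloring. *)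

theory Defs
  imports "HOL-Analysis.Analysis"
begin

text \<open>A graph is given by its vertex set and its set of edges; edges are two-element sets of vertices.\<close>

definition simple_graph :: "'a set \<Rightarrow> 'a set set \<Rightarrow> bool" where
  "simple_graph V E \<longleftrightarrow> finite V \<and> (\<forall>e\<in>E. e \<subseteq> V \<and> card e = 2)"

definition degree :: "'a set set \<Rightarrow> 'a \<Rightarrow> nat" where
  "degree E v = card {e \<in> E. v \<in> e}"

definition max_degree :: "'a set \<Rightarrow> 'a set set \<Rightarrow> nat" where
  "max_degree V E = Max (degree E ` V)"

definition mad :: "'a set \<Rightarrow> 'a set set \<Rightarrow> real" where
  "mad V E = Max {2 * real (card F) / real (card W) | W F.
     W \<subseteq> V \<and> W \<noteq> {} \<and> F \<subseteq> E \<and> simple_graph W F}"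

definition graph_path :: "'a set \<Rightarrow> 'a set set \<Rightarrow> 'a list \<Rightarrow> bool" where
  "graph_path V E xs \<longleftrightarrow>
     xs \<noteq> [] \<and> set xs \<subseteq> V \<and> distinct xs \<and> successively (\<lambda>u v. {u, v} \<in> E) xs"

text \<open>A path or cycle is recorded as its list of vertices, so a path has one edge fewer than the
  length of its list, and a cycle (whose closing edge joins the last vertex to the first) has
  exactly as many. The infimum of the empty set in \<^typ>\<open>enat\<close> is infinite, as required for
  vertices in different components and for acyclic graphs.\<close>

definition graph_dist :: "'a set \<Rightarrow> 'a set set \<Rightarrow> 'a \<Rightarrow> 'a \<Rightarrow> enat" where
  "graph_dist V E v w =
     (INF xs \<in> {xs. graph_path V E xs \<and> hd xs = v \<and> last xs = w}. enat (length xs - 1))"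

definition graph_cycle :: "'a set \<Rightarrow> 'a set set \<Rightarrow> 'a list \<Rightarrow> bool" where
  "graph_cycle V E xs \<longleftrightarrow> graph_path V E xs \<and> 3 \<le> length xs \<and> {last xs, hd xs} \<in> E"

definition girth :: "'a set \<Rightarrow> 'a set set \<Rightarrow> enat" where
  "girth V E = (INF xs \<in> {xs. graph_cycle V E xs}. enat (length xs))"

text \<open>A drawing in the plane, identified with \<^typ>\<open>complex\<close>: distinct vertices are distinct
  points, each edge is an arc joining its two ends and passing through no other vertex, and
  two different edges meet at most in a common end.\<close>

definition plane_drawing ::
    "'a set \<Rightarrow> 'a set set \<Rightarrow> ('a \<Rightarrow> complex) \<Rightarrow> ('a set \<Rightarrow> real \<Rightarrow> complex) \<Rightarrow> bool" where
  "plane_drawing V E p \<gamma> \<longleftrightarrow>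
     inj_on p V \<and>
     (\<forall>e\<in>E. arc (\<gamma> e) \<and> {pathstart (\<gamma> e), pathfinish (\<gamma> e)} = p ` e \<and>
             path_image (\<gamma> e) \<inter> p ` V = p ` e) \<and>
     (\<forall>e\<in>E. \<forall>e'\<in>E. e \<noteq> e' \<longrightarrow> path_image (\<gamma> e) \<inter> path_image (\<gamma> e') \<subseteq> p ` (e \<inter> e'))"

definition planar_graph :: "'a set \<Rightarrow> 'a set set \<Rightarrow> bool" where
  "planar_graph V E \<longleftrightarrow> (\<exists>p \<gamma>. plane_drawing V E p \<gamma>)"

definition tone_coloring :: "nat \<Rightarrow> nat \<Rightarrow> 'a set \<Rightarrow> 'a set set \<Rightarrow> ('a \<Rightarrow> nat set) \<Rightarrow> bool" where
  "tone_coloring t k V E f \<longleftrightarrow>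
     (\<forall>v\<in>V. f v \<subseteq> {1..k} \<and> card (f v) = t) \<and>
     (\<forall>v\<in>V. \<forall>w\<in>V. v \<noteq> w \<longrightarrow> enat (card (f v \<inter> f w)) < graph_dist V E v w)"

definition tone_chromatic_number :: "nat \<Rightarrow> 'a set \<Rightarrow> 'a set set \<Rightarrow> nat" where
  "tone_chromatic_number t V E = (LEAST k. 0 < k \<and> (\<exists>f. tone_coloring t k V E f))"

end

theory Submission
  imports Defs
begin

text \<open>With two labels per vertex only distances one and two matter: labels of adjacent vertices are
  disjoint, labels of vertices with a common neighbor are distinct. A vertex of degree
  \<open>\<Delta>\<close> therefore needs \<open>C(k - 2, 2) \<ge> \<Delta>\<close>, which is the lower bound.

  For the upper bound let \<open>k \<ge> 7\<close> and \<open>C(k - 2, 2) \<ge> \<Delta>\<close>, and consider a minimal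
  counterexample. Extending colorings greedily excludes vertices of degree at most one, three
  consecutive vertices of degree two unless both ends of that thread have degree at least
  \<open>C(k - 2, 2) \<ge> 10\<close>, and vertices of degree three with too many vertices of degree two nearby.
  Discharging from the initial charge \<open>5 d(v) - 12\<close> then gives average degree at least 12/5.

  For planar graphs of girth at least 12 the bound \<open>mad < 12/5\<close> comes from an edge count that avoids
  faces: for a cycle \<open>C\<close> with \<open>m\<close> edges and \<open>n\<close> vertices inside,
  \<open>10 m \<le> 12 n + |C| - 12\<close>, by induction, splitting the inside of \<open>C\<close> along a path.
  Taking \<open>C\<close> with nothing inside and inverting the plane at a point inside \<open>C\<close> puts the whole graph
  inside \<open>C\<close>.\<close>

section \<open>Extending partial colorings\<close>

text \<open>Deleting vertices can lose the constraint between two remaining vertices whose common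
  neighbors are all gone. Hence every deleted set S is chosen so that each vertex of S has at most
  one neighbor outside S. For \<open>k = 7\<close> a vertex with one colored neighbor has C(5,2) =
  10 candidate labels; with two it may have only C(3,2) = 3, but at least C(4,2) = 6 if these two
  share a color. In the configurations at a vertex of degree three, the last vertex to be colored
  has three labels at distance two against three candidates. The way out is to choose an earlier
  label so that a color is shared or one of the three labels cannot be a candidate. In the planar
  part, splitting the inside of a cycle needs a path between two different vertices of that cycle.
  This is why a connectivity condition enters and why the edge count is finally glued along cut
  vertices. The inversion is needed because the count sees only what lies inside a cycle.\<close>

definition labels :: "nat \<Rightarrow> nat set set" where
  "labels k = {L. L \<subseteq> {1..k} \<and> card L = 2}"

lemma label_finite: "L \<in> labels k \<Longrightarrow> finite L"
  by (auto simp: labels_def intro: finite_subset)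

lemma label_nonempty: "L \<in> labels k \<Longrightarrow> L \<noteq> {}"
  by (auto simp: labels_def)

lemma finite_labels: "finite (labels k)"
  by (rule finite_subset[of _ "Pow {1..k}"]) (auto simp: labels_def)

lemma card_labels_avoiding:
  assumes "a \<subseteq> {1..k}"
  shows "card {L \<in> labels k. L \<inter> a = {}} = (k - card a) choose 2"
proof -
  have "{L \<in> labels k. L \<inter> a = {}} = {L. L \<subseteq> {1..k} - a \<and> card L = 2}"
    by (auto simp: labels_def)
  moreover have "card ({1..k} - a) = k - card a"
    using assms by (simp add: card_Diff_subset finite_subset)
  ultimately show ?thesis
    by (simp add: n_subsets)
qed

lemma choose_two_mono: "m \<le> n \<Longrightarrow> m choose 2 \<le> n choose 2" for m n :: nat
  unfolding choose_two by (intro div_le_mono mult_le_mono) auto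

lemma label_choice:
  assumes "a \<subseteq> {1..k}" "card a \<le> j" "finite X" "card X < (k - j) choose 2"
  obtains L where "L \<in> labels k" "L \<inter> a = {}" "L \<notin> X"
proof -
  have "(k - j) choose 2 \<le> (k - card a) choose 2"
    using assms(2) by (intro choose_two_mono) auto
  hence "card X < card {L \<in> labels k. L \<inter> a = {}}"
    using card_labels_avoiding[OF assms(1)] assms(4) by linarith
  hence "\<not> {L \<in> labels k. L \<inter> a = {}} \<subseteq> X"
    using assms(3) card_mono leD by blast
  thus thesis using that by blast
qed

text \<open>The values at \<open>k = 7\<close>, in order: candidates left by one label, by two
  disjoint labels, and by two labels sharing a color.\<close>

lemma choose_two_ge:
  assumes "7 \<le> (k::nat)"
  shows "10 \<le> (k - 2) choose 2" "3 \<le> (k - 4) choose 2" "6 \<le> (k - 3) choose 2"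
proof -
  have "(5::nat) choose 2 \<le> (k - 2) choose 2" "(3::nat) choose 2 \<le> (k - 4) choose 2"
    "(4::nat) choose 2 \<le> (k - 3) choose 2"
    using assms by (auto intro!: choose_two_mono)
  thus "10 \<le> (k - 2) choose 2" "3 \<le> (k - 4) choose 2" "6 \<le> (k - 3) choose 2"
    by (simp_all add: choose_two)
qed

text \<open>If a and w are disjoint, more labels avoid w (there are C(k-2,2)) than avoid both
  (there are C(k-4,2)), by 2k - 7 \<open>\<ge>\<close> 7.\<close>

lemma label_choice_meeting:
  assumes k: "7 \<le> k" and a: "a \<in> labels k" and w: "w \<in> labels k" and X: "finite X" "card X \<le> 5"
  obtains L where "L \<in> labels k" "L \<inter> w = {}" "L \<notin> X" "L \<inter> a \<noteq> {} \<or> a \<inter> w \<noteq> {}"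
proof (cases "a \<inter> w = {}")
  case False
  have "card w \<le> 2" "w \<subseteq> {1..k}" using w by (auto simp: labels_def)
  moreover have "card X < (k - 2) choose 2" using choose_two_ge(1)[OF k] X(2) by linarith
  ultimately obtain L where "L \<in> labels k" "L \<inter> w = {}" "L \<notin> X"
    using X(1) label_choice[of w k 2 X] by metis
  thus thesis using that False by blast
next
  case True
  let ?S = "{L \<in> labels k. L \<inter> w = {}}" and ?T = "{L \<in> labels k. L \<inter> (a \<union> w) = {}}"
  have aw: "card (a \<union> w) = 4" "a \<union> w \<subseteq> {1..k}" "card w = 2" "w \<subseteq> {1..k}"
    using a w True label_finite[OF a] label_finite[OF w] by (auto simp: labels_def card_Un_disjoint)
  have Suc_choose: "Suc n choose 2 = n + (n choose 2)" for n
    using binomial_Suc_Suc[of n 1] by (simp only: Suc_1 choose_one)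
  have "k - 2 = Suc (Suc (k - 4))" using k by linarith
  hence "(k - 2) choose 2 = Suc (k - 4) + ((k - 4) + ((k - 4) choose 2))"
    by (simp only: Suc_choose)
  moreover have "card ?T = (k - 4) choose 2" "card ?S = (k - 2) choose 2"
    using card_labels_avoiding[OF aw(2)] card_labels_avoiding[OF aw(4)] by (simp_all only: aw)
  ultimately have "card (?T \<union> X) < card ?S"
    using card_Un_le[of ?T X] X k by linarith
  hence "\<not> ?S \<subseteq> ?T \<union> X"
    using X(1) finite_labels[of k] card_mono[of "?T \<union> X" ?S] by (auto simp: not_le)
  then obtain L where "L \<in> ?S" "L \<notin> ?T" "L \<notin> X" by blast
  thus thesis using that by blast
qed

section \<open>Partial colorings and their extension by one vertex\<close>

definition nbh :: "('a \<Rightarrow> 'a \<Rightarrow> bool) \<Rightarrow> 'a set \<Rightarrow> 'a \<Rightarrow> 'a set" where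
  "nbh adj V u = {w \<in> V. adj u w}"

text \<open>This is mad < 12/5, restricted to induced subgraphs, which have the most edges on their
  vertex set, and cleared of denominators.\<close>

definition low_density :: "('a \<Rightarrow> 'a \<Rightarrow> bool) \<Rightarrow> 'a set \<Rightarrow> bool" where
  "low_density adj V \<longleftrightarrow>
     (\<forall>W\<subseteq>V. W \<noteq> {} \<longrightarrow> 5 * (\<Sum>u\<in>W. card (nbh adj W u)) < 12 * card W)"

text \<open>Only W is colored, but the middle vertex of a path of length two may be any vertex of V, so that
  a coloring can be extended vertex by vertex.\<close>

definition partial_coloring ::
    "('a \<Rightarrow> 'a \<Rightarrow> bool) \<Rightarrow> nat \<Rightarrow> 'a set \<Rightarrow> 'a set \<Rightarrow> ('a \<Rightarrow> nat set) \<Rightarrow> bool" where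
  "partial_coloring adj k V W f \<longleftrightarrow>
     (\<forall>u\<in>W. f u \<in> labels k) \<and>
     (\<forall>u\<in>W. \<forall>v\<in>W. adj u v \<longrightarrow> f u \<inter> f v = {}) \<and>
     (\<forall>u\<in>W. \<forall>v\<in>W. \<forall>c\<in>V. u \<noteq> v \<and> adj u c \<and> adj c v \<longrightarrow> f u \<noteq> f v)"

text \<open>A subgraph is obtained by shrinking V under a fixed \<open>adj\<close> and a fixed k, so
  that the induction stays within this locale.\<close>

locale bounded_degree_graph =
  fixes adj :: "'a \<Rightarrow> 'a \<Rightarrow> bool" and k :: nat and V :: "'a set"
  assumes adj_sym: "adj u v \<Longrightarrow> adj v u"
    and adj_irrefl: "\<not> adj u u"
    and k7: "7 \<le> k"
    and finV: "finite V"
    and degree_le: "u \<in> V \<Longrightarrow> card (nbh adj V u) \<le> (k - 2) choose 2"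
begin

abbreviation N where "N \<equiv> nbh adj V"
abbreviation d where "d u \<equiv> card (N u)"
abbreviation good where "good \<equiv> partial_coloring adj k V"

lemma N_sym: "u \<in> V \<Longrightarrow> v \<in> N u \<Longrightarrow> u \<in> N v"
  by (auto simp: nbh_def adj_sym)

lemma finN: "finite (N u)"
  using finV by (simp add: nbh_def)

lemma not_self: "u \<notin> N u"
  by (simp add: nbh_def adj_irrefl)

lemma N_V: "v \<in> N u \<Longrightarrow> v \<in> V"
  by (simp add: nbh_def)

text \<open>Enlarging the ambient graph from W to V only adds paths of length two whose middle
  vertex is outside W, and such a vertex has at most one neighbor in W.\<close>

lemma good_lift:
  assumes "partial_coloring adj k W W f" "W \<subseteq> V"
    and "\<And>c u v. c \<in> V - W \<Longrightarrow> u \<in> N c \<inter> W \<Longrightarrow> v \<in> N c \<inter> W \<Longrightarrow> u = v"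
  shows "good W f"
proof -
  have "f u \<noteq> f v" if "u \<in> W" "v \<in> W" "c \<in> V" "u \<noteq> v" "adj u c" "adj c v" for u v c
  proof (cases "c \<in> W")
    case True
    thus ?thesis using assms(1) that unfolding partial_coloring_def by blast
  next
    case False
    thus ?thesis using assms(3)[of c u v] that assms(2) by (auto simp: nbh_def adj_sym)
  qed
  thus ?thesis using assms(1) by (auto simp: partial_coloring_def)
qed

lemma good_label: "good W f \<Longrightarrow> w \<in> W \<Longrightarrow> f w \<in> labels k"
  by (simp add: partial_coloring_def)

text \<open>A vertex at distance two via c that is also adjacent to u needs no second exclusion,
  since disjoint nonempty labels differ. This keeps the lists of forbidden labels short in the
  presence of triangles.\<close>

lemma good_insert:
  assumes "good W f" "u \<in> V" "u \<notin> W" "W \<subseteq> V" and L: "L \<in> labels k"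
    and 1: "\<forall>w \<in> N u \<inter> W. L \<inter> f w = {}"
    and 2: "\<forall>c \<in> N u. \<forall>w \<in> N c \<inter> W. w \<notin> N u \<longrightarrow> L \<noteq> f w"
  shows "\<exists>f'. good (insert u W) f' \<and> f' u = L \<and> (\<forall>w\<in>W. f' w = f w)"
proof (intro exI[of _ "f(u := L)"] conjI)
  have far: "L \<noteq> f w" if "w \<in> W" "c \<in> V" "adj u c" "adj c w" for w c
  proof (cases "w \<in> N u")
    case True
    hence "L \<inter> f w = {}" using 1 that by blast
    thus ?thesis using label_nonempty[OF L] by auto
  next
    case False
    moreover have "c \<in> N u" "w \<in> N c \<inter> W" using that assms(4) by (auto simp: nbh_def)
    ultimately show ?thesis using 2 by blast
  qed
  show "good (insert u W) (f(u := L))"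
    unfolding partial_coloring_def
  proof (intro conjI ballI impI)
    fix v assume "v \<in> insert u W"
    thus "(f(u := L)) v \<in> labels k" using L good_label[OF assms(1)] by auto
  next
    fix v w assume vw: "v \<in> insert u W" "w \<in> insert u W" "adj v w"
    have *: "L \<inter> f z = {}" if "z \<in> W" "adj u z" for z
      using 1 that assms(4) by (auto simp: nbh_def)
    show "(f(u := L)) v \<inter> (f(u := L)) w = {}"
    proof -
      consider "v = u" "w = u" | "v = u" "w \<noteq> u" | "v \<noteq> u" "w = u" | "v \<noteq> u" "w \<noteq> u" by blast
      thus ?thesis
      proof cases
        case 1 thus ?thesis using vw adj_irrefl by auto
      next
        case 2 thus ?thesis using vw *[of w] by auto
      next
        case 3 thus ?thesis using vw *[of v] adj_sym by auto
      next
        case 4 thus ?thesis using vw assms(1) by (auto simp: partial_coloring_def)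
      qed
    qed
  next
    fix v w c assume vw: "v \<in> insert u W" "w \<in> insert u W" "c \<in> V" "v \<noteq> w \<and> adj v c \<and> adj c w"
    consider "v = u" "w \<noteq> u" | "v \<noteq> u" "w = u" | "v \<noteq> u" "w \<noteq> u" using vw by blast
    thus "(f(u := L)) v \<noteq> (f(u := L)) w"
    proof cases
      case 1 thus ?thesis using vw far[of w c] by auto
    next
      case 2 thus ?thesis using vw far[of v c] adj_sym by fastforce
    next
      case 3
      hence "f v \<noteq> f w" using vw assms(1) unfolding partial_coloring_def by blast
      thus ?thesis using 3 by simp
    qed
  qed
  show "(f(u := L)) u = L" by simp
  show "\<forall>w\<in>W. (f(u := L)) w = f w" using assms(3) by auto
qed

text \<open>At most j colored neighbors block at most 2j colors, and D collects the vertices whose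
  labels are forbidden as a whole. B and D are supersets, so explicit sets can be supplied.\<close>

lemma good_extend:
  assumes g: "good W f" "u \<in> V" "u \<notin> W" "W \<subseteq> V"
    and B: "N u \<inter> W \<subseteq> B" "finite B" "card B \<le> j"
    and D: "\<And>c w. c \<in> N u \<Longrightarrow> w \<in> N c \<inter> W \<Longrightarrow> w \<notin> N u \<Longrightarrow> w \<in> D" "finite D"
      "card D < (k - 2 * j) choose 2"
  obtains f' where "good (insert u W) f'" "\<And>w. w \<in> W \<Longrightarrow> f' w = f w"
proof -
  have lab: "f w \<in> labels k" if "w \<in> N u \<inter> W" for w using good_label[OF g(1)] that by blast
  have "card (\<Union>w\<in>N u \<inter> W. f w) \<le> (\<Sum>w\<in>N u \<inter> W. card (f w))"
    using finN by (intro card_UN_le) auto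
  also have "\<dots> = (\<Sum>w\<in>N u \<inter> W. 2)"
    using lab by (intro sum.cong) (auto simp: labels_def)
  also have "\<dots> \<le> 2 * j"
    using B card_mono[of B "N u \<inter> W"] by simp
  finally have c: "card (\<Union>w\<in>N u \<inter> W. f w) \<le> 2 * j" .
  have s: "(\<Union>w\<in>N u \<inter> W. f w) \<subseteq> {1..k}" using lab by (auto simp: labels_def)
  have "card (f ` D) < (k - 2 * j) choose 2"
    using D(2,3) card_image_le[of D f] by linarith
  then obtain L where L: "L \<in> labels k" "L \<inter> (\<Union>w\<in>N u \<inter> W. f w) = {}" "L \<notin> f ` D"
    using label_choice[OF s c, of "f ` D"] D(2) by blast
  have 1: "\<forall>w \<in> N u \<inter> W. L \<inter> f w = {}" using L(2) by blast
  have 2: "\<forall>c \<in> N u. \<forall>w \<in> N c \<inter> W. w \<notin> N u \<longrightarrow> L \<noteq> f w"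
    using D(1) L(3) by blast
  obtain f' where f': "good (insert u W) f'" "f' u = L" "\<And>w. w \<in> W \<Longrightarrow> f' w = f w"
    using good_insert[OF g L(1) 1 2] by blast
  show thesis by (rule that[OF f'(1,3)])
qed

lemma good_extend1:
  assumes "good W f" "u \<in> V" "u \<notin> W" "W \<subseteq> V" "N u \<inter> W \<subseteq> {b}"
    and "\<And>c w. c \<in> N u \<Longrightarrow> w \<in> N c \<inter> W \<Longrightarrow> w \<notin> N u \<Longrightarrow> w \<in> D" "finite D"
      "card D < (k - 2) choose 2"
  obtains f' where "good (insert u W) f'" "\<And>w. w \<in> W \<Longrightarrow> f' w = f w"
  by (rule good_extend[OF assms(1-5), of 1 D]) (use assms(6-) that in auto)

text \<open>Two colored neighbors may leave just C(3,2) = 3 labels, so two vertices at distance two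
  are all that can be afforded.\<close>

lemma good_extend2:
  assumes "good W f" "u \<in> V" "u \<notin> W" "W \<subseteq> V" "N u \<inter> W \<subseteq> {b, c}"
    and "\<And>c w. c \<in> N u \<Longrightarrow> w \<in> N c \<inter> W \<Longrightarrow> w \<notin> N u \<Longrightarrow> w \<in> {x, y}"
  obtains f' where "good (insert u W) f'" "\<And>w. w \<in> W \<Longrightarrow> f' w = f w"
proof (rule good_extend[OF assms(1-5) _ _ assms(6)])
  show "card {x, y} < (k - 2 * 2) choose 2"
    using choose_two_ge(2)[OF k7] card_insert_le_m1[of 2 "{y}" x] by simp
  show "card {b, c} \<le> 2" using card_insert_le_m1[of 2 "{c}" b] by simp
qed (use that in auto)

text \<open>Preparation for \<open>good_extend_final\<close>: u and v will be the colored neighbors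
  of the last vertex, and b will be at distance two from it. Either u and v share a color, or the
  label of b meets that of v and cannot be a candidate for the last vertex.\<close>

lemma good_extend_meeting:
  assumes g: "good W f" "u \<in> V" "u \<notin> W" "W \<subseteq> V"
    and B: "N u \<inter> W \<subseteq> {b}" and D: "\<And>c w. c \<in> N u \<Longrightarrow> w \<in> N c \<inter> W \<Longrightarrow> w \<notin> N u \<Longrightarrow> w \<in> D"
      "finite D" "card D \<le> 5" and v: "v \<in> W" "b \<in> W"
  obtains f' where "good (insert u W) f'" "\<And>w. w \<in> W \<Longrightarrow> f' w = f w"
    "f' u \<inter> f' v \<noteq> {} \<or> f' v \<inter> f' b \<noteq> {}"
proof -
  have "card (f ` D) \<le> 5" using card_image_le[OF D(2), of f] D(3) by linarith
  then obtain L where L: "L \<in> labels k" "L \<inter> f b = {}" "L \<notin> f ` D" "L \<inter> f v \<noteq> {} \<or> f v \<inter> f b \<noteq> {}"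
    using label_choice_meeting[OF k7 good_label[OF g(1) v(1)] good_label[OF g(1) v(2)], of "f ` D"] D(2)
    by blast
  have 1: "\<forall>w \<in> N u \<inter> W. L \<inter> f w = {}"
  proof
    fix w assume "w \<in> N u \<inter> W"
    hence "w = b" using B by blast
    thus "L \<inter> f w = {}" using L(2) by simp
  qed
  have 2: "\<forall>c \<in> N u. \<forall>w \<in> N c \<inter> W. w \<notin> N u \<longrightarrow> L \<noteq> f w"
    using D(1) L(3) by blast
  obtain f' where f': "good (insert u W) f'" "f' u = L" "\<And>w. w \<in> W \<Longrightarrow> f' w = f w"
    using good_insert[OF g L(1) 1 2] by blast
  show thesis by (rule that[OF f'(1,3)]) (use f' L v in auto)
qed

text \<open>The labels of v and y occupy at most three colors, or the label of w is not
  among the candidates for u anyway.\<close>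

lemma good_extend_final:
  assumes g: "good W f" "u \<in> V" "u \<notin> W" "W \<subseteq> V"
    and B: "N u \<inter> W \<subseteq> {v, y}"
    and D: "\<And>c w'. c \<in> N u \<Longrightarrow> w' \<in> N c \<inter> W \<Longrightarrow> w' \<notin> N u \<Longrightarrow> w' \<in> {w, p, q}"
    and m: "f y \<inter> f v \<noteq> {} \<or> f v \<inter> f w \<noteq> {}" and v: "v \<in> W" "y \<in> W"
  obtains f' where "good (insert u W) f'"
proof -
  have lab: "f v \<in> labels k" "f y \<in> labels k" using good_label[OF g(1)] v by auto
  have fin: "finite (f v)" "finite (f y)" using lab by (auto intro: label_finite)
  have s: "f v \<union> f y \<subseteq> {1..k}" using lab by (auto simp: labels_def)
  have card: "card (f v \<union> f y) + card (f v \<inter> f y) = 4"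
    using lab card_Un_Int[OF fin] by (simp add: labels_def)
  obtain L where L: "L \<in> labels k" "L \<inter> (f v \<union> f y) = {}" "L \<notin> {f w, f p, f q}"
  proof (cases "f v \<inter> f y = {}")
    case True
    have "card {f p, f q} < (k - 4) choose 2"
      using choose_two_ge(2)[OF k7] card_insert_le_m1[of 2 "{f q}" "f p"] by simp
    then obtain L where L: "L \<in> labels k" "L \<inter> (f v \<union> f y) = {}" "L \<notin> {f p, f q}"
      using label_choice[OF s, of 4 "{f p, f q}"] card by (metis finite.emptyI finite.insertI le_add1)
    moreover have "L \<noteq> f w" using m True L(2) by blast
    ultimately show thesis using that by blast
  next
    case False
    hence "0 < card (f v \<inter> f y)" using fin by (simp add: card_gt_0_iff)
    hence c3: "card (f v \<union> f y) \<le> 3" using card by linarith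
    have "card {f w, f p, f q} \<le> 3"
      using card_insert_le_m1[of 3 "{f p, f q}" "f w"] card_insert_le_m1[of 2 "{f q}" "f p"] by simp
    hence "card {f w, f p, f q} < (k - 3) choose 2"
      using choose_two_ge(3)[OF k7] by linarith
    thus thesis using label_choice[OF s c3, of "{f w, f p, f q}"] that by blast
  qed
  have 1: "\<forall>w \<in> N u \<inter> W. L \<inter> f w = {}"
  proof
    fix z assume "z \<in> N u \<inter> W"
    hence "z = v \<or> z = y" using B by blast
    thus "L \<inter> f z = {}" using L(2) by blast
  qed
  have 2: "\<forall>c \<in> N u. \<forall>w \<in> N c \<inter> W. w \<notin> N u \<longrightarrow> L \<noteq> f w"
    using D(1) L(3) by blast
  obtain f' where f': "good (insert u W) f'"
    using good_insert[OF g L(1) 1 2] by blast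
  thus thesis by (rule that)
qed

section \<open>Reducible configurations\<close>

definition colorable where "colorable W \<longleftrightarrow> (\<exists>f. partial_coloring adj k W W f)"

lemma good_restrict:
  assumes "colorable (V - S)"
    and "\<And>c u v. c \<in> S \<Longrightarrow> c \<in> V \<Longrightarrow> u \<in> N c - S \<Longrightarrow> v \<in> N c - S \<Longrightarrow> u = v"
  obtains f where "good (V - S) f"
proof -
  obtain f where "partial_coloring adj k (V - S) (V - S) f"
    using assms(1) by (auto simp: colorable_def)
  hence "good (V - S) f"
    by (rule good_lift) (use assms(2) in auto)
  thus thesis by (rule that)
qed

lemma colorableI: "good V f \<Longrightarrow> colorable V"
  by (auto simp: colorable_def)

lemma card_N_minus: "v \<in> N u \<Longrightarrow> card (N u - {v}) = d u - 1"
  by (simp add: finN)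

lemma d_pos: "v \<in> N u \<Longrightarrow> 0 < d u"
  using finN[of u] by (auto simp: card_gt_0_iff)

text \<open>A neighbor b of v has at most C(k - 2, 2) - 1 other neighbors, one fewer than there are
  labels disjoint from that of b.\<close>

lemma reduce_leaf:
  assumes v: "v \<in> V" "d v \<le> 1" and IH: "colorable (V - {v})"
  shows "colorable V"
proof -
  have one: "u = w" if "u \<in> N v" "w \<in> N v" for u w
    using v(2) card_le_Suc0_iff_eq[OF finN, of v] that by simp
  obtain f where f: "good (V - {v}) f"
  proof (rule good_restrict[OF IH])
    show "u = w" if "c \<in> {v}" "u \<in> N c - {v}" "w \<in> N c - {v}" for c u w
    proof (rule one)
      show "u \<in> N v" "w \<in> N v" using that by simp_all
    qed
  qed
  have "\<exists>f'. good (insert v (V - {v})) f'"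
  proof (cases "N v = {}")
    case True
    show ?thesis
      by (rule good_extend1[OF f, of v v "{}"])
        (use v(1) True k7 choose_two_ge(1)[OF k7] in auto)
  next
    case False
    then obtain b where b: "b \<in> N v" by blast
    hence Nv: "N v = {b}" using one by blast
    have vb: "v \<in> N b" "b \<in> V" using N_sym[OF v(1) b] N_V[OF b] by auto
    have "card (N b - {v}) < (k - 2) choose 2"
      using card_N_minus[OF vb(1)] d_pos[OF vb(1)] degree_le[OF vb(2)] by simp
    note c = this
    show ?thesis
      by (rule good_extend1[OF f, of v b "N b - {v}"]) (use v(1) finN Nv c in auto)
  qed
  thus ?thesis using v(1) by (auto intro: colorableI simp: insert_absorb)
qed

text \<open>Along a - x - y - z - b the middle y comes last: its neighbors x, z and the vertices a,
  b at distance two fit \<open>good_extend2\<close>. As x is colored before z, z must also avoid the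
  label of x, which is why the bound at b is strict.\<close>

lemma reduce_thread:
  assumes x: "x \<in> V" "y \<in> V" "z \<in> V" and N: "N x = {a, y}" "N y = {x, z}" "N z = {y, b}"
    and ne: "a \<noteq> y" "x \<noteq> z" "b \<noteq> y" and b: "d b < (k - 2) choose 2"
    and IH: "colorable (V - {x, y, z})"
  shows "colorable V"
proof -
  have xyz: "x \<noteq> y" "y \<noteq> z" "a \<noteq> x" "b \<noteq> z" "a \<in> V" "b \<in> V"
    using N not_self[of x] not_self[of y] not_self[of z] N_V[of a x] N_V[of b z] by auto
  obtain f where f: "good (V - {x, y, z}) f"
    by (rule good_restrict[OF IH]) (use N in auto)
  let ?W = "V - {x, y, z}"
  show ?thesis
  proof (cases "a = z")
    case True
    \<comment> \<open>Here x, y, z form a triangle with no edges to the rest of the graph.\<close>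
    have "b = x" using N True N_sym[of x z] x ne xyz by auto
    note N' = N[unfolded True this]
    obtain f1 where f1: "good (insert x ?W) f1"
      by (rule good_extend1[OF f, of x x "{}"])
        (use N' x xyz ne k7 choose_two_ge(1)[OF k7] in auto)
    obtain f2 where f2: "good (insert y (insert x ?W)) f2"
      by (rule good_extend1[OF f1, of y x "{}"])
        (use N' x xyz ne k7 choose_two_ge(1)[OF k7] in auto)
    obtain f3 where f3: "good (insert z (insert y (insert x ?W))) f3"
      by (rule good_extend2[OF f2, of z x y x y])
        (use N' x xyz ne k7 choose_two_ge(1)[OF k7] in auto)
    moreover have "insert z (insert y (insert x ?W)) = V" using x by auto
    ultimately show ?thesis by (metis colorableI)
  next
    case False
    have bx: "b \<noteq> x" using N N_sym[of z x] x False ne xyz by auto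
    have xa: "x \<in> N a" "z \<in> N b" using N N_sym x by auto
    have ca: "card (N a - {x}) < (k - 2) choose 2"
      using card_N_minus[OF xa(1)] d_pos[OF xa(1)] degree_le[OF \<open>a \<in> V\<close>] by simp
    have "card (insert x (N b - {z})) \<le> Suc (card (N b - {z}))"
      by (rule card_insert_le_m1) auto
    hence cb: "card (insert x (N b - {z})) < (k - 2) choose 2"
      using card_N_minus[OF xa(2)] d_pos[OF xa(2)] b by simp
    obtain f1 where f1: "good (insert x ?W) f1"
      by (rule good_extend1[OF f, of x a "N a - {x}"]) (use N x xyz ne ca finN in auto)
    obtain f2 where f2: "good (insert z (insert x ?W)) f2"
      by (rule good_extend1[OF f1, of z b "insert x (N b - {z})"])
        (use N x xyz ne cb finN bx False in auto)
    obtain f3 where f3: "good (insert y (insert z (insert x ?W))) f3"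
      by (rule good_extend2[OF f2, of y x z a b]) (use N x xyz ne in auto)
    moreover have "insert y (insert z (insert x ?W)) = V" using x by auto
    ultimately show ?thesis by (metis colorableI)
  qed
qed

text \<open>Covers the degenerate case of threads at v that close up, so that the next two
  configurations can assume their vertices distinct.\<close>

lemma reduce_triangle:
  assumes V: "v \<in> V" "x1 \<in> V" "x2 \<in> V" "x3 \<in> V"
    and N: "N v = {x1, x2, x3}" "N x1 = {v, x2}" "N x2 = {v, x1}"
    and ne: "x1 \<noteq> x2" "x1 \<noteq> x3" "x2 \<noteq> x3" and d: "d x3 \<le> 5"
    and IH: "colorable (V - {v, x1, x2})"
  shows "colorable V"
proof -
  have ne': "v \<noteq> x1" "v \<noteq> x2" "v \<noteq> x3"
    using N not_self[of v] by auto
  let ?W = "V - {v, x1, x2}"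
  obtain f where f: "good ?W f"
    by (rule good_restrict[OF IH]) (use N in auto)
  have v3: "v \<in> N x3" using N N_sym V by auto
  have c: "card (N x3 - {v}) < (k - 2) choose 2"
    using card_N_minus[OF v3] d choose_two_ge(1)[OF k7] by simp
  obtain f1 where f1: "good (insert v ?W) f1"
    by (rule good_extend1[OF f, of v x3 "N x3 - {v}"]) (use N V ne ne' c finN in auto)
  obtain f2 where f2: "good (insert x1 (insert v ?W)) f2"
    by (rule good_extend1[OF f1, of x1 v "{x3}"])
      (use N V ne ne' choose_two_ge(1)[OF k7] in auto)
  obtain f3 where f3: "good (insert x2 (insert x1 (insert v ?W))) f3"
    by (rule good_extend2[OF f2, of x2 v x1 x3 x3]) (use N V ne ne' in auto)
  moreover have "insert x2 (insert x1 (insert v ?W)) = V" using V by auto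
  ultimately show ?thesis by (metis colorableI)
qed

text \<open>The order of coloring is y1, v, y2, x1, x2. At the end x2 has the neighbors v, y2 and
  the vertices w2, x3, x1 at distance two, one too many for three candidates; so y2 is colored by
  \<open>good_extend_meeting\<close>.\<close>

lemma reduce_two_long:
  assumes V: "v \<in> V" "x1 \<in> V" "x2 \<in> V" "x3 \<in> V" "y1 \<in> V" "y2 \<in> V" "w1 \<in> V" "w2 \<in> V"
    and N: "N v = {x1, x2, x3}" "N x1 = {v, y1}" "N y1 = {x1, w1}" "N x2 = {v, y2}" "N y2 = {x2, w2}"
    and ne: "distinct [v, x1, x2, x3, y1, y2]" "w1 \<notin> {v, x1, x2, y1, y2}" "w2 \<notin> {v, x1, x2, y1, y2}"
    and d: "d w2 \<le> 5" "d x3 \<le> 5"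
    and IH: "colorable (V - {v, x1, x2, y1, y2})"
  shows "colorable V"
proof -
  let ?W = "V - {v, x1, x2, y1, y2}"
  obtain f where f: "good ?W f"
    by (rule good_restrict[OF IH]) (use N ne in auto)
  have mem: "y1 \<in> N w1" "y2 \<in> N w2" "v \<in> N x3" using N N_sym V by auto
  have c1: "card (N w1 - {y1}) < (k - 2) choose 2"
    using card_N_minus[OF mem(1)] d_pos[OF mem(1)] degree_le[OF \<open>w1 \<in> V\<close>] by simp
  have c2: "card (insert v (N w2 - {y2})) \<le> 5"
    using card_N_minus[OF mem(2)] d_pos[OF mem(2)] d card_insert_le_m1[of 5 "N w2 - {y2}" v] by simp
  have "card (insert y1 (N x3 - {v})) \<le> 5"
    using card_N_minus[OF mem(3)] d_pos[OF mem(3)] d card_insert_le_m1[of 5 "N x3 - {v}" y1] by simp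
  hence c3: "card (insert y1 (N x3 - {v})) < (k - 2) choose 2"
    using choose_two_ge(1)[OF k7] by linarith
  obtain f1 where f1: "good (insert y1 ?W) f1"
    by (rule good_extend1[OF f, of y1 w1 "N w1 - {y1}"]) (use N V ne c1 finN in auto)
  obtain f2 where f2: "good (insert v (insert y1 ?W)) f2"
    by (rule good_extend1[OF f1, of v x3 "insert y1 (N x3 - {v})"]) (use N V ne c3 finN in auto)
  let ?W3 = "insert v (insert y1 ?W)"
  obtain f3 where f3: "good (insert y2 ?W3) f3" "f3 y2 \<inter> f3 v \<noteq> {} \<or> f3 v \<inter> f3 w2 \<noteq> {}"
    by (rule good_extend_meeting[OF f2, of y2 w2 "insert v (N w2 - {y2})" v])
      (use N V ne c2 finN in auto)
  obtain f4 where f4: "good (insert x1 (insert y2 ?W3)) f4" "\<And>w. w \<in> insert y2 ?W3 \<Longrightarrow> f4 w = f3 w"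
    by (rule good_extend2[OF f3(1), of x1 v y1 w1 x3]) (use N V ne in auto)
  have 4: "f4 y2 \<inter> f4 v \<noteq> {} \<or> f4 v \<inter> f4 w2 \<noteq> {}"
    using f3(2) f4(2)[of y2] f4(2)[of v] f4(2)[of w2] V ne by simp
  obtain f5 where f5: "good (insert x2 (insert x1 (insert y2 ?W3))) f5"
    by (rule good_extend_final[OF f4(1) _ _ _ _ _ 4, of x2 x3 x1]) (use N V ne in auto)
  have "insert x2 (insert x1 (insert y2 ?W3)) = V" using V by blast
  thus ?thesis using f5 by (intro colorableI[of f5]) simp
qed

text \<open>The order of coloring is x2, x3, v, y1, x1. Coloring y1 after v leaves only w2 and w3 at
  distance two from v. The last vertex x1 has three such vertices, w1, x2, x3, which again calls for
  \<open>good_extend_meeting\<close> at y1.\<close>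

lemma reduce_one_long:
  assumes V: "v \<in> V" "x1 \<in> V" "x2 \<in> V" "x3 \<in> V" "y1 \<in> V" "w1 \<in> V" "w2 \<in> V" "w3 \<in> V"
    and N: "N v = {x1, x2, x3}" "N x1 = {v, y1}" "N y1 = {x1, w1}" "N x2 = {v, w2}" "N x3 = {v, w3}"
    and ne: "distinct [v, x1, x2, x3, y1]" "w1 \<notin> {v, x1, x2, x3, y1}" "w2 \<notin> {v, x1, x2, x3, y1}"
      "w3 \<notin> {v, x1, x2, x3, y1}"
    and d: "d w1 \<le> 5" "d w2 \<le> 5" "d w3 \<le> 5"
    and IH: "colorable (V - {v, x1, x2, x3, y1})"
  shows "colorable V"
proof -
  let ?W = "V - {v, x1, x2, x3, y1}"
  obtain f where f: "good ?W f"
    by (rule good_restrict[OF IH]) (use N ne in auto)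
  have mem: "y1 \<in> N w1" "x2 \<in> N w2" "x3 \<in> N w3" using N N_sym V by auto
  have c1: "card (insert v (N w1 - {y1})) \<le> 5"
    using card_N_minus[OF mem(1)] d_pos[OF mem(1)] d card_insert_le_m1[of 5 "N w1 - {y1}" v] by simp
  have c2: "card (N w2 - {x2}) < (k - 2) choose 2"
    using card_N_minus[OF mem(2)] d choose_two_ge(1)[OF k7] by simp
  have "card (insert x2 (N w3 - {x3})) \<le> 5"
    using card_N_minus[OF mem(3)] d_pos[OF mem(3)] d card_insert_le_m1[of 5 "N w3 - {x3}" x2] by simp
  hence c3: "card (insert x2 (N w3 - {x3})) < (k - 2) choose 2"
    using choose_two_ge(1)[OF k7] by linarith
  obtain f1 where f1: "good (insert x2 ?W) f1"
    by (rule good_extend1[OF f, of x2 w2 "N w2 - {x2}"]) (use N V ne c2 finN in auto)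
  obtain f2 where f2: "good (insert x3 (insert x2 ?W)) f2"
    by (rule good_extend1[OF f1, of x3 w3 "insert x2 (N w3 - {x3})"]) (use N V ne c3 finN in auto)
  let ?W2 = "insert x3 (insert x2 ?W)"
  obtain f3 where f3: "good (insert v ?W2) f3"
    by (rule good_extend2[OF f2, of v x2 x3 w2 w3]) (use N V ne in auto)
  obtain f4 where f4: "good (insert y1 (insert v ?W2)) f4" "f4 y1 \<inter> f4 v \<noteq> {} \<or> f4 v \<inter> f4 w1 \<noteq> {}"
    by (rule good_extend_meeting[OF f3, of y1 w1 "insert v (N w1 - {y1})" v])
      (use N(2,3) V ne(1,2) c1 finN in auto)
  obtain f5 where f5: "good (insert x1 (insert y1 (insert v ?W2))) f5"
    by (rule good_extend_final[OF f4(1) _ _ _ _ _ f4(2), of x1 x2 x3]) (use N V ne in auto)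
  have "insert x1 (insert y1 (insert v ?W2)) = V" using V by blast
  thus ?thesis using f5 by (intro colorableI[of f5]) simp
qed

end

section \<open>Discharging\<close>

locale minimal_uncolorable = bounded_degree_graph +
  assumes uncolorable: "\<not> colorable V"
    and smaller_colorable: "W \<subset> V \<Longrightarrow> colorable W"
begin

text \<open>Six is the least degree d for which the charge 5 d - 12 covers 3 per neighbor. A vertex
  that is not big has degree at most 5, the bound that the reductions at a vertex of degree three
  ask for.\<close>

abbreviation big where "big u \<equiv> 6 \<le> d u"

definition near_big where "near_big x \<longleftrightarrow> (\<exists>u\<in>N x. big u)"

text \<open>The charge that v sends to its neighbor x. A big vertex pays for its whole thread of vertices of
  degree two, so its first vertex passes one unit on to the second.\<close>

definition gives :: "'a \<Rightarrow> 'a \<Rightarrow> int" where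
  "gives v x =
     (if big v then 3
      else if d v = 2 then (if near_big v \<and> d x = 2 then 1 else 0)
      else if d x \<noteq> 2 \<or> near_big x then 0
      else if \<exists>u\<in>N x. u \<noteq> v \<and> d u = 2 \<and> \<not> near_big u then 2
      else 1)"

section \<open>Threads of vertices of degree two in a minimal counterexample\<close>

lemma degree_ge2: "v \<in> V \<Longrightarrow> 2 \<le> d v"
  using reduce_leaf[of v] smaller_colorable[of "V - {v}"] uncolorable by fastforce

lemma N_degree_two:
  assumes "x \<in> V" "d x = 2" "v \<in> N x"
  obtains y where "N x = {v, y}" "y \<noteq> v" "y \<in> V" "x \<in> N y" "x \<in> N v" "v \<in> V"
proof -
  obtain a b where ab: "N x = {a, b}" "a \<noteq> b" using assms(2) by (auto simp: card_2_iff)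
  then obtain y where y: "N x = {v, y}" "y \<noteq> v" using assms(3) by auto
  have yx: "y \<in> N x" using y by simp
  have "y \<in> V" "x \<in> N y" using N_V[OF yx] N_sym[OF assms(1) yx] by simp_all
  thus thesis using that y N_V[OF assms(3)] N_sym[OF assms(1,3)] by blast
qed

text \<open>Only one end is treated; reversing the thread gives the other. The reduction even yields
  degree at least 10, but discharging needs only six.\<close>

lemma thread_end_big:
  assumes "x \<in> V" "y \<in> V" "z \<in> V" "N x = {a, y}" "N y = {x, z}" "N z = {y, b}"
    "a \<noteq> y" "x \<noteq> z" "b \<noteq> y"
  shows "big b"
proof (rule ccontr)
  assume "\<not> big b"
  hence "d b < (k - 2) choose 2" using choose_two_ge(1)[OF k7] by linarith
  hence "colorable V"
    by (rule reduce_thread[OF assms]) (use smaller_colorable assms in blast)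
  thus False using uncolorable by simp
qed

lemma gives_bounds: "0 \<le> gives v x" "gives v x \<le> 3" "\<not> big v \<Longrightarrow> gives v x \<le> 2"
  unfolding gives_def by simp_all

lemma gives_pos:
  assumes "\<not> big v" "d v \<noteq> 2" "0 < gives v x"
  shows "d x = 2" "\<not> near_big x"
  using assms unfolding gives_def by presburger+

text \<open>Paying 2 signals a thread v - x - y - w without a big end. If w had degree two as well,
  three such vertices in a row would make v big; if w were big, y would be
  \<open>near_big\<close>.\<close>

lemma gives_long:
  assumes v: "v \<in> V" "\<not> big v" "d v \<noteq> 2" and x: "x \<in> N v" "gives v x = 2"
  obtains y w where "N x = {v, y}" "y \<noteq> v" "N y = {x, w}" "w \<noteq> x" "y \<in> V" "w \<in> V"
    "3 \<le> d w" "d w \<le> 5"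
proof -
  have dx: "d x = 2" "\<not> near_big x" using gives_pos[of v x] v x by auto
  have xV: "x \<in> V" "v \<in> N x" using N_V[OF x(1)] N_sym[OF v(1) x(1)] by simp_all
  have "\<exists>u\<in>N x. u \<noteq> v \<and> d u = 2 \<and> \<not> near_big u"
    using v x(2) dx unfolding gives_def by presburger
  then obtain y where y: "y \<in> N x" "y \<noteq> v" "d y = 2" "\<not> near_big y" by blast
  obtain y' where y': "N x = {v, y'}" using N_degree_two[OF xV(1) dx(1) xV(2)] by metis
  have Nx: "N x = {v, y}" using y(1,2) unfolding y' by simp
  have yV: "y \<in> V" "x \<in> N y" using N_V[OF y(1)] N_sym[OF xV(1) y(1)] by simp_all
  obtain w where w: "N y = {x, w}" "w \<noteq> x" "w \<in> V" "y \<in> N w"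
    using N_degree_two[OF yV(1) y(3) yV(2)] by metis
  have "d w \<noteq> 2"
  proof
    assume "d w = 2"
    then obtain b where b: "N w = {y, b}" "b \<noteq> y"
      using N_degree_two[OF w(3) _ w(4)] by blast
    have "N w = {b, y}" "N y = {w, x}" "N x = {y, v}" using b(1) w(1) Nx by (simp_all add: insert_commute)
    hence "big v"
      using thread_end_big[of w y x b v] w(2,3) yV(1) xV(1) b(2) y(2) by blast
    thus False using v by simp
  qed
  moreover have "\<not> big w" using y(4) w(1) by (auto simp: near_big_def)
  ultimately have "3 \<le> d w" "d w \<le> 5" using degree_ge2[OF w(3)] by linarith+
  thus thesis using that Nx y w yV by blast
qed

text \<open>In the second alternative w may be big: then v pays only 1, because y passes on 1 from
  w. Hence no upper bound on its degree.\<close>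

lemma gives_thread:
  assumes v: "v \<in> V" "\<not> big v" "d v \<noteq> 2" and x: "x \<in> N v" "0 < gives v x"
  obtains y where "N x = {v, y}" "y \<noteq> v" "y \<in> V" "3 \<le> d y" "d y \<le> 5"
  | y w where "N x = {v, y}" "y \<noteq> v" "N y = {x, w}" "w \<noteq> x" "y \<in> V" "w \<in> V" "3 \<le> d w"
proof -
  have dx: "d x = 2" "\<not> near_big x" using gives_pos[of v x] v x by auto
  have xV: "x \<in> V" "v \<in> N x" using N_V[OF x(1)] N_sym[OF v(1) x(1)] by simp_all
  obtain y where y: "N x = {v, y}" "y \<noteq> v" "y \<in> V" "x \<in> N y"
    using N_degree_two[OF xV(1) dx(1) xV(2)] by metis
  have nb: "\<not> big y" using dx(2) y(1) by (auto simp: near_big_def)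
  show thesis
  proof (cases "d y = 2")
    case False
    hence "3 \<le> d y" "d y \<le> 5" using degree_ge2[OF y(3)] nb by linarith+
    thus thesis using that(1) y by blast
  next
    case True
    obtain w where w: "N y = {x, w}" "w \<noteq> x" "w \<in> V" "y \<in> N w"
      using N_degree_two[OF y(3) True y(4)] by metis
    have "d w \<noteq> 2"
    proof
      assume "d w = 2"
      then obtain b where b: "N w = {y, b}" "b \<noteq> y"
        using N_degree_two[OF w(3) _ w(4)] by metis
      have "N w = {b, y}" "N y = {w, x}" "N x = {y, v}"
        using b(1) w(1) y(1) by (simp_all add: insert_commute)
      hence "big v"
        using thread_end_big[of w y x b v] w(2,3) y(2,3) xV(1) b(2) by blast
      thus False using v by simp
    qed
    hence "3 \<le> d w" using degree_ge2[OF w(3)] by linarith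
    thus thesis using that(2) y w by blast
  qed
qed

lemma no_triangle:
  assumes V: "v \<in> V" "x1 \<in> V" "x2 \<in> V" "x3 \<in> V"
    and N: "N v = {x1, x2, x3}" "N x1 = {v, x2}" "N x2 = {v, x1}"
    and ne: "x1 \<noteq> x2" "x1 \<noteq> x3" "x2 \<noteq> x3" and d: "d x3 \<le> 5"
  shows False
  using reduce_triangle[OF assms smaller_colorable] V uncolorable by blast

text \<open>The first thread is given by its vertices and not by \<open>gives v x1 = 2\<close>,
  since its far end may be big; \<open>no_one_long\<close> needs this generality. Most of the proof
  separates the named vertices so that \<open>reduce_two_long\<close> applies.\<close>

lemma no_two_long:
  assumes v: "v \<in> V" "\<not> near_big v" and Nv: "N v = {x1, x2, x3}" and ne: "distinct [x1, x2, x3]"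
    and 1: "N x1 = {v, y1}" "y1 \<noteq> v" "N y1 = {x1, w1}" "w1 \<noteq> x1" "3 \<le> d w1" "y1 \<in> V" "w1 \<in> V"
    and 2: "gives v x2 = 2"
  shows False
proof -
  have dv: "d v = 3" using Nv ne by simp
  have xV: "x1 \<in> V" "x2 \<in> V" "x3 \<in> V" "x2 \<in> N v"
    using Nv N_V[of x1 v] N_V[of x2 v] N_V[of x3 v] by auto
  obtain y2 w2 where 2: "N x2 = {v, y2}" "y2 \<noteq> v" "N y2 = {x2, w2}" "w2 \<noteq> x2" "y2 \<in> V" "w2 \<in> V"
    "3 \<le> d w2" "d w2 \<le> 5"
    using gives_long[OF v(1) _ _ xV(4) 2] dv by auto
  have dx: "d x1 = 2" "d x2 = 2" "d y1 = 2" "d y2 = 2" using 1 2 by auto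
  have d3: "d x3 \<le> 5" using v(2) Nv by (auto simp: near_big_def not_le)
  have nvx: "v \<noteq> x1" "v \<noteq> x2" "v \<noteq> x3" "y1 \<noteq> x1" "y2 \<noteq> x2"
    using Nv not_self[of v] not_self[of x1] not_self[of x2] 1(1) 2(1) by auto
  \<comment> \<open>If y1 or y2 coincides with a neighbor of v, a triangle at v arises.\<close>
  have y12: "y1 \<noteq> x2"
  proof
    assume a: "y1 = x2"
    have "y2 = x1" using a 1(3) 2(1) nvx by (auto simp: doubleton_eq_iff)
    thus False using no_triangle[OF v(1) xV(1-3) Nv _ _ _ _ _ d3] a 1(1) 2(1) ne by auto
  qed
  have y13: "y1 \<noteq> x3"
  proof
    assume a: "y1 = x3"
    have "v \<in> N x3" using N_sym[OF v(1)] Nv by simp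
    hence "w1 = v" using a 1(3) nvx by auto
    thus False
      using no_triangle[OF v(1) xV(1,3,2)] a 1 Nv ne dx(2) by (auto simp: insert_commute)
  qed
  have y23: "y2 \<noteq> x3"
  proof
    assume a: "y2 = x3"
    have "v \<in> N x3" using N_sym[OF v(1)] Nv by simp
    hence "w2 = v" using a 2(3) nvx by auto
    thus False
      using no_triangle[OF v(1) xV(2,3,1)] a 2 Nv ne dx(1) by (auto simp: insert_commute)
  qed
  have y21: "y2 \<noteq> x1"
  proof
    assume "y2 = x1"
    hence "y1 = x2" using 2(3) 1(1) nvx by (auto simp: doubleton_eq_iff)
    thus False using y12 by simp
  qed
  \<comment> \<open>The two threads would merge and w1 would be x2, which has degree two.\<close>
  have y1y2: "y1 \<noteq> y2"
  proof
    assume "y1 = y2"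
    hence "w1 = x2" using 1(3) 2(3) ne by (auto simp: doubleton_eq_iff)
    thus False using 1(5) dx by simp
  qed
  have "w1 \<in> N y1" "w2 \<in> N y2" using 1(3) 2(3) by simp_all
  hence "y1 \<in> N w1" "y2 \<in> N w2" using N_sym 1(6) 2(5) by blast+
  moreover have "y1 \<notin> N v" "y2 \<notin> N v" unfolding Nv using nvx y12 y13 y21 y23 by simp_all
  ultimately have wv: "w1 \<noteq> v" "w2 \<noteq> v" by blast+
  have "w \<notin> {v, x1, x2, y1, y2}" if "w \<noteq> v" "3 \<le> d w" for w
  proof
    assume "w \<in> {v, x1, x2, y1, y2}"
    hence "d w = 2" using that(1) dx by fastforce
    thus False using that(2) by simp
  qed
  hence "w1 \<notin> {v, x1, x2, y1, y2}" "w2 \<notin> {v, x1, x2, y1, y2}"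
    using wv 1(5) 2(7) by blast+
  moreover have "distinct [v, x1, x2, x3, y1, y2]"
    using ne nvx y12 y13 y21 y23 y1y2 1(2) 2(2) by auto
  ultimately have "colorable V"
    using reduce_two_long[OF v(1) xV(1-3) 1(6) 2(5) 1(7) 2(6) Nv 1(1) 1(3) 2(1) 2(3) _ _ _ 2(8) d3]
      smaller_colorable[of "V - {v, x1, x2, y1, y2}"] v(1) by blast
  thus False using uncolorable by simp
qed

text \<open>A long thread behind x2 or x3 would be a case of \<open>no_two_long\<close>. So both are
  single vertices of degree two with a far end of degree 3 to 5, which is the configuration of
  \<open>reduce_one_long\<close>.\<close>

lemma no_one_long:
  assumes v: "v \<in> V" "\<not> near_big v" and Nv: "N v = {x1, x2, x3}" and ne: "distinct [x1, x2, x3]"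
    and 1: "gives v x1 = 2" and 2: "0 < gives v x2" and 3: "0 < gives v x3"
  shows False
proof -
  have dv: "d v = 3" using Nv ne by simp
  have xV: "x1 \<in> V" "x2 \<in> V" "x3 \<in> V"
    using Nv N_V[of x1 v] N_V[of x2 v] N_V[of x3 v] by auto
  have xN: "x1 \<in> N v" "x2 \<in> N v" "x3 \<in> N v" using Nv by auto
  have nv: "\<not> big v" "d v \<noteq> 2" using dv by auto
  obtain y1 w1 where y1: "N x1 = {v, y1}" "y1 \<noteq> v" "N y1 = {x1, w1}" "w1 \<noteq> x1" "y1 \<in> V" "w1 \<in> V"
    "3 \<le> d w1" "d w1 \<le> 5"
    using gives_long[OF v(1) nv xN(1) 1] by blast
  obtain w2 where w2: "N x2 = {v, w2}" "w2 \<noteq> v" "w2 \<in> V" "3 \<le> d w2" "d w2 \<le> 5"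
  proof (rule gives_thread[OF v(1) nv xN(2) 2])
    fix y w assume "N x2 = {v, y}" "y \<noteq> v" "N y = {x2, w}" "w \<noteq> x2" "y \<in> V" "w \<in> V" "3 \<le> d w"
    thus thesis using no_two_long[OF v, of x2 x1 x3 y w] 1 Nv ne by auto
  qed (use that in blast)
  obtain w3 where w3: "N x3 = {v, w3}" "w3 \<noteq> v" "w3 \<in> V" "3 \<le> d w3" "d w3 \<le> 5"
  proof (rule gives_thread[OF v(1) nv xN(3) 3])
    fix y w assume "N x3 = {v, y}" "y \<noteq> v" "N y = {x3, w}" "w \<noteq> x3" "y \<in> V" "w \<in> V" "3 \<le> d w"
    thus thesis using no_two_long[OF v, of x3 x1 x2 y w] 1 Nv ne by auto
  qed (use that in blast)
  have dx: "d x1 = 2" "d x2 = 2" "d x3 = 2" "d y1 = 2" using y1 w2 w3 by auto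
  have nvx: "v \<noteq> x1" "v \<noteq> x2" "v \<noteq> x3" "y1 \<noteq> x1"
    using Nv not_self[of v] not_self[of x1] y1(1) by auto
  have x1N: "x1 \<in> N y1" using y1(3) by simp
  have y1x: "y1 \<noteq> x2" "y1 \<noteq> x3"
    using x1N w2(1,4) w3(1,4) dx nvx by auto
  have "w1 \<in> N y1" using y1(3) by simp
  hence "y1 \<in> N w1" using N_sym[OF y1(5)] by blast
  moreover have "y1 \<notin> N v" unfolding Nv using nvx y1x by simp
  ultimately have w1v: "w1 \<noteq> v" by blast
  have "w \<notin> {v, x1, x2, x3, y1}" if "w \<noteq> v" "3 \<le> d w" for w
  proof
    assume "w \<in> {v, x1, x2, x3, y1}"
    hence "d w = 2" using that(1) dx by fastforce
    thus False using that(2) by simp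
  qed
  hence "w1 \<notin> {v, x1, x2, x3, y1}" "w2 \<notin> {v, x1, x2, x3, y1}" "w3 \<notin> {v, x1, x2, x3, y1}"
    using w1v w2(2,4) w3(2,4) y1(7) by blast+
  moreover have "distinct [v, x1, x2, x3, y1]" using ne nvx y1x y1(2) by auto
  ultimately have "colorable V"
    using reduce_one_long[OF v(1) xV y1(5,6) w2(3) w3(3) Nv y1(1,3) w2(1) w3(1) _ _ _ _ y1(8) w2(5) w3(5)]
      smaller_colorable[of "V - {v, x1, x2, x3, y1}"] v(1) by blast
  thus False using uncolorable by simp
qed

text \<open>The initial charge is 3. A big neighbor pays 3 and receives nothing, and the other two
  cost at most 4. Without a big neighbor, a total of at least 4 includes a payment of 2 beside which
  the others sum to at least 2: both are positive or one of them is 2, and either is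
  excluded.\<close>

lemma final_charge_three:
  assumes v: "v \<in> V" "d v = 3"
  shows "-3 \<le> (\<Sum>w\<in>N v. gives w v - gives v w)"
proof -
  obtain x1 x2 x3 where x: "N v = {x1, x2, x3}" "distinct [x1, x2, x3]"
    using v(2) by (auto simp: card_3_iff)
  have s: "(\<Sum>w\<in>N v. gives w v - gives v w)
      = (gives x1 v - gives v x1) + (gives x2 v - gives v x2) + (gives x3 v - gives v x3)"
    using x by simp
  have nb: "\<not> big v" "d v \<noteq> 2" using v by auto
  note b = gives_bounds(1)[of x1 v] gives_bounds(1)[of x2 v] gives_bounds(1)[of x3 v]
    gives_bounds(1)[of v x1] gives_bounds(1)[of v x2] gives_bounds(1)[of v x3]
    gives_bounds(3)[OF nb(1), of x1] gives_bounds(3)[OF nb(1), of x2] gives_bounds(3)[OF nb(1), of x3]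
  show ?thesis
  proof (cases "near_big v")
    case True
    have *: "gives w v - gives v w = 3" if "big w" for w
    proof -
      have "d w \<noteq> 2" using that by linarith
      thus ?thesis using that nb unfolding gives_def by simp
    qed
    have "big x1 \<or> big x2 \<or> big x3" using True x unfolding near_big_def by simp
    thus ?thesis unfolding s using b *[of x1] *[of x2] *[of x3] by (elim disjE) linarith+
  next
    case False
    \<comment> \<open>Stated for every order of the neighbors, so that a payment of 2 can be moved
      to the front.\<close>
    have *: False if y: "N v = {y1, y2, y3}" "distinct [y1, y2, y3]" "gives v y1 = 2"
      "gives v y2 + gives v y3 \<ge> 2" for y1 y2 y3
    proof -
      have b: "0 \<le> gives v y2" "gives v y2 \<le> 2" "0 \<le> gives v y3" "gives v y3 \<le> 2"
        using gives_bounds(1)[of v] gives_bounds(3)[OF nb(1)] by simp_all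
      consider "0 < gives v y2" "0 < gives v y3" | "gives v y2 = 2" | "gives v y3 = 2"
        using y(4) b by linarith
      thus False
      proof cases
        case 1
        thus ?thesis using no_one_long[OF v(1) False y(1-3)] by blast
      next
        case 2
        have eq: "N v = {y2, y1, y3}" "distinct [y2, y1, y3]"
          using y(1,2) by (simp_all add: insert_commute eq_commute)
        have "y2 \<in> N v" using y(1) by simp
        then obtain z w where "N y2 = {v, z}" "z \<noteq> v" "N z = {y2, w}" "w \<noteq> y2" "3 \<le> d w" "z \<in> V" "w \<in> V"
          using gives_long[OF v(1) nb _ 2] by metis
        thus ?thesis using no_two_long[OF v(1) False eq _ _ _ _ _ _ _ y(3)] by metis
      next
        case 3
        have eq: "N v = {y3, y1, y2}" "distinct [y3, y1, y2]"
          using y(1,2) by (simp_all add: insert_commute eq_commute)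
        have "y3 \<in> N v" using y(1) by simp
        then obtain z w where "N y3 = {v, z}" "z \<noteq> v" "N z = {y3, w}" "w \<noteq> y3" "3 \<le> d w" "z \<in> V" "w \<in> V"
          using gives_long[OF v(1) nb _ 3] by metis
        thus ?thesis using no_two_long[OF v(1) False eq _ _ _ _ _ _ _ y(3)] by metis
      qed
    qed
    have "gives v x1 + gives v x2 + gives v x3 \<le> 3"
    proof (rule ccontr)
      assume "\<not> ?thesis"
      hence c: "gives v x1 + gives v x2 + gives v x3 \<ge> 4" by simp
      then consider "gives v x1 = 2" | "gives v x2 = 2" | "gives v x3 = 2" using b by linarith
      thus False
      proof cases
        case 1 thus ?thesis using *[OF x(1,2)] c by linarith
      next
        case 2
        have "N v = {x2, x1, x3}" "distinct [x2, x1, x3]"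
          using x by (simp_all add: insert_commute eq_commute)
        thus ?thesis using *[of x2 x1 x3] c 2 by linarith
      next
        case 3
        have "N v = {x3, x1, x2}" "distinct [x3, x1, x2]"
          using x by (simp_all add: insert_commute eq_commute)
        thus ?thesis using *[of x3 x1 x2] c 3 by linarith
      qed
    qed
    thus ?thesis unfolding s using b by linarith
  qed
qed

text \<open>The deficit is 2. A big neighbor pays 3, of which at most 1 is passed on. Otherwise a
  neighbor of degree at least three pays 1, or 2 if the other neighbor has degree two and no big
  vertex to draw on; a neighbor of degree two that has one passes on 1. In the middle of three
  vertices of degree two both ends are big, so each side passes on 1.\<close>

lemma final_charge_two:
  assumes x: "x \<in> V" "d x = 2"
  shows "2 \<le> (\<Sum>w\<in>N x. gives w x - gives x w)"
proof -
  obtain p q where pq: "N x = {p, q}" "p \<noteq> q" using x(2) by (auto simp: card_2_iff)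
  have pqV: "p \<in> V" "q \<in> V" "x \<in> N p" "x \<in> N q"
    using pq N_V[of p x] N_V[of q x] N_sym[OF x(1), of p] N_sym[OF x(1), of q] by auto
  have s: "(\<Sum>w\<in>N x. gives w x - gives x w)
      = (gives p x - gives x p) + (gives q x - gives x q)"
    using pq by simp
  have nb: "\<not> big x" using x by simp
  show ?thesis
  proof (cases "near_big x")
    case True
    have *: "gives w x - gives x w \<ge> 3" if "big w" for w
    proof -
      have "d w \<noteq> 2" using that by linarith
      thus ?thesis using that nb x unfolding gives_def by simp
    qed
    have "gives x w \<le> 1" for w using nb x unfolding gives_def by simp
    hence "gives w x - gives x w \<ge> -1" for w using gives_bounds(1)[of w x] by (smt (verit))
    moreover have "big p \<or> big q" using True pq unfolding near_big_def by simp
    ultimately show ?thesis unfolding s using * by (smt (verit))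
  next
    case False
    have out: "gives x w = 0" for w using False nb x unfolding gives_def by simp
    have s': "(\<Sum>w\<in>N x. gives w x - gives x w) = gives p x + gives q x"
      unfolding s by (simp add: out)
    have nbig: "\<not> big p" "\<not> big q" using False pq unfolding near_big_def by simp_all
    have G1: "1 \<le> gives w x" if "d w \<noteq> 2" for w
      using that False x unfolding gives_def by simp
    have G2: "gives w x = 2" if "d w \<noteq> 2" "\<not> big w" "u \<in> N x" "u \<noteq> w" "d u = 2" "\<not> near_big u" for u w
    proof -
      have "\<exists>u\<in>N x. u \<noteq> w \<and> d u = 2 \<and> \<not> near_big u" using that by blast
      thus ?thesis using that(1,2) False x unfolding gives_def by simp
    qed
    have G3: "gives w x = 1" if "d w = 2" "near_big w" for w
      using that x unfolding gives_def by simp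
    consider "d p \<noteq> 2" "d q \<noteq> 2" | "d p \<noteq> 2" "d q = 2" | "d p = 2" "d q \<noteq> 2" | "d p = 2" "d q = 2"
      by blast
    thus ?thesis
    proof cases
      case 1
      thus ?thesis unfolding s' using G1[of p] G1[of q] pq by simp
    next
      case 2
      thus ?thesis unfolding s'
        using G1[of p] G2[of p q] G3[of q] gives_bounds(1)[of q x] pq nbig by (cases "near_big q") simp_all
    next
      case 3
      thus ?thesis unfolding s'
        using G1[of q] G2[of q p] G3[of p] gives_bounds(1)[of p x] pq nbig by (cases "near_big p") simp_all
    next
      case 4
      obtain a where a: "N p = {x, a}" "a \<noteq> x" using N_degree_two[OF pqV(1) 4(1) pqV(3)] by blast
      obtain b where b: "N q = {x, b}" "b \<noteq> x" using N_degree_two[OF pqV(2) 4(2) pqV(4)] by blast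
      have eqs: "N p = {a, x}" "N q = {b, x}" "N x = {q, p}"
        using a b pq by (simp_all add: insert_commute)
      have "big b"
        by (rule thread_end_big[OF pqV(1) x(1) pqV(2) eqs(1) pq(1) b(1) a(2) pq(2) b(2)])
      moreover have "big a"
        by (rule thread_end_big[OF pqV(2) x(1) pqV(1) eqs(2,3) a(1) b(2) pq(2)[symmetric] a(2)])
      ultimately have "near_big p" "near_big q" using a b unfolding near_big_def by simp_all
      thus ?thesis unfolding s' using G3 4 by simp
    qed
  qed
qed

text \<open>For degrees 4 and 5 a loss of 2 per neighbor leaves 3 d - 12, and for big vertices a
  loss of 3 per neighbor leaves 2 d - 12.\<close>

lemma final_charge_nonneg:
  assumes "u \<in> V"
  shows "0 \<le> 5 * int (d u) - 12 + (\<Sum>w\<in>N u. gives w u - gives u w)"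
proof -
  consider "d u = 2" | "d u = 3" | "4 \<le> d u" "\<not> big u" | "big u"
    using degree_ge2[OF assms] by linarith
  thus ?thesis
  proof cases
    case 1 thus ?thesis using final_charge_two[OF assms] by simp
  next
    case 2 thus ?thesis using final_charge_three[OF assms] by simp
  next
    case 3
    have "int (d u) * (-2) \<le> (\<Sum>w\<in>N u. gives w u - gives u w)"
      using sum_bounded_below[of "N u" "-2" "\<lambda>w. gives w u - gives u w"]
        gives_bounds(1)[of _ u] gives_bounds(3)[OF 3(2)] by (smt (verit))
    thus ?thesis using 3 by linarith
  next
    case 4
    have "int (d u) * (-3) \<le> (\<Sum>w\<in>N u. gives w u - gives u w)"
      using sum_bounded_below[of "N u" "-3" "\<lambda>w. gives w u - gives u w"]
        gives_bounds(1)[of _ u] gives_bounds(2)[of u] by (smt (verit))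
    thus ?thesis using 4 by linarith
  qed
qed

lemma average_degree_ge: "12 * card V \<le> 5 * (\<Sum>u\<in>V. d u)"
proof -
  \<comment> \<open>Adjacency is symmetric, so the total received equals the total sent.\<close>
  have "(\<Sum>u\<in>V. \<Sum>w\<in>N u. gives w u) = (\<Sum>u\<in>V. \<Sum>w\<in>N u. gives u w)"
    unfolding nbh_def using finV adj_sym
    by (subst sum.swap_restrict) (auto intro!: sum.cong)
  hence "(\<Sum>u\<in>V. \<Sum>w\<in>N u. gives w u - gives u w) = 0"
    by (simp add: sum_subtractf)
  moreover have "0 \<le> (\<Sum>u\<in>V. 5 * int (d u) - 12 + (\<Sum>w\<in>N u. gives w u - gives u w))"
    by (intro sum_nonneg final_charge_nonneg)
  ultimately have "0 \<le> 5 * (\<Sum>u\<in>V. int (d u)) - 12 * int (card V)"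
    by (simp add: sum.distrib sum_subtractf sum_distrib_left)
  thus ?thesis by (simp flip: of_nat_sum)
qed

end

theorem low_density_colorable:
  assumes "bounded_degree_graph adj k V" "low_density adj V"
  obtains f where "partial_coloring adj k V V f"
proof -
  have "finite V" using assms(1) by (simp add: bounded_degree_graph_def)
  hence "bounded_degree_graph.colorable adj k V" using assms
  proof (induction V rule: finite_psubset_induct)
    case (psubset V)
    interpret bounded_degree_graph adj k V by (rule psubset.prems)
    show ?case
    proof (rule ccontr)
      assume unc: "\<not> colorable V"
      have "colorable W" if W: "W \<subset> V" for W
      proof -
        have "card (nbh adj W u) \<le> (k - 2) choose 2" if "u \<in> W" for u
          using degree_le[of u] that W card_mono[OF finN, of "nbh adj W u" u]
          by (force simp: nbh_def)
        hence "bounded_degree_graph adj k W"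
          using W finV k7 adj_sym adj_irrefl
          by (auto simp: bounded_degree_graph_def intro: finite_subset)
        moreover have "low_density adj W"
          using psubset.prems(2) W by (auto simp: low_density_def)
        ultimately have "bounded_degree_graph.colorable adj k W" using psubset.IH W by blast
        thus ?thesis using \<open>bounded_degree_graph adj k W\<close> by (simp add: colorable_def bounded_degree_graph.colorable_def)
      qed
      then interpret minimal_uncolorable adj k V
        using unc by unfold_locales
      have "V \<noteq> {}" using unc by (auto simp: colorable_def partial_coloring_def)
      thus False using psubset.prems(2) average_degree_ge by (auto simp: low_density_def)
    qed
  qed
  thus thesis using that bounded_degree_graph.colorable_def[OF assms(1)] by blast
qed

section \<open>Paths and cycles as edge sets\<close>

fun path_edges :: "'a list \<Rightarrow> 'a set set" where
  "path_edges (x # y # zs) = insert {x, y} (path_edges (y # zs))"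
| "path_edges _ = {}"

lemma path_edges_append: "path_edges (xs @ a # ys) = path_edges (xs @ [a]) \<union> path_edges (a # ys)"
proof (induction xs rule: path_edges.induct)
  case (1 x y zs)
  thus ?case by simp
qed auto

lemma path_edges_rev: "path_edges (rev xs) = path_edges xs"
proof (induction xs rule: path_edges.induct)
  case (1 x y zs)
  have "path_edges (rev zs @ y # [x]) = path_edges (rev zs @ [y]) \<union> {{y, x}}"
    by (subst path_edges_append) simp
  thus ?case using 1 by (simp add: insert_commute)
qed auto

lemma path_edges_subset: "e \<in> path_edges xs \<Longrightarrow> e \<subseteq> set xs"
  by (induction xs rule: path_edges.induct) auto

lemma Union_path_edges: "2 \<le> length xs \<Longrightarrow> \<Union> (path_edges xs) = set xs"
proof (induction xs rule: path_edges.induct)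
  case (1 x y zs)
  thus ?case by (cases zs) auto
qed auto

lemma finite_path_edges [simp]: "finite (path_edges xs)"
  by (induction xs rule: path_edges.induct) auto

lemma card_path_edges: "distinct xs \<Longrightarrow> card (path_edges xs) = length xs - 1"
proof (induction xs rule: path_edges.induct)
  case (1 x y zs)
  have "{x, y} \<notin> path_edges (y # zs)" using path_edges_subset[of "{x, y}" "y # zs"] 1 by auto
  thus ?case using 1 by simp
qed auto

lemma path_edges_card_2: "distinct xs \<Longrightarrow> e \<in> path_edges xs \<Longrightarrow> card e = 2"
  by (induction xs rule: path_edges.induct) auto

lemma ends_path_edges:
  assumes "distinct xs" "{hd xs, last xs} \<in> path_edges xs"
  shows "length xs = 2"
proof -
  consider "xs = []" | x where "xs = [x]" | x y zs where "xs = x # y # zs"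
    by (metis list.exhaust)
  thus ?thesis
  proof cases
    case (3 x y zs)
    have "{x, last xs} \<notin> path_edges (y # zs)"
      using path_edges_subset[of "{x, last xs}" "y # zs"] assms(1) 3 by auto
    hence "last xs = y" using assms 3 by (auto simp: doubleton_eq_iff split: if_splits)
    thus ?thesis using assms(1) 3 by (cases zs) (auto split: if_splits)
  qed (use assms in auto)
qed

lemma successively_path_edges:
  "successively (\<lambda>u v. {u, v} \<in> E) xs \<longleftrightarrow> path_edges xs \<subseteq> E"
  by (induction xs rule: path_edges.induct) auto

lemma rtrancl_imp_distinct_path:
  assumes "(u, v) \<in> {(x, y). x \<in> S \<and> y \<in> S \<and> {x, y} \<in> E}\<^sup>*" "u \<in> S"
  obtains xs where "distinct xs" "xs \<noteq> []" "hd xs = u" "last xs = v" "set xs \<subseteq> S" "path_edges xs \<subseteq> E"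
proof -
  have "\<exists>xs. distinct xs \<and> xs \<noteq> [] \<and> hd xs = u \<and> last xs = v \<and> set xs \<subseteq> S \<and> path_edges xs \<subseteq> E"
    using assms(1)
  proof (induction rule: rtrancl_induct)
    case base
    show ?case by (rule exI[of _ "[u]"]) (use assms(2) in auto)
  next
    case (step y z)
    then obtain xs where xs: "distinct xs" "xs \<noteq> []" "hd xs = u" "last xs = y" "set xs \<subseteq> S" "path_edges xs \<subseteq> E"
      by blast
    show ?case
    proof (cases "z \<in> set xs")
      case True
      then obtain us vs where "xs = us @ z # vs" by (meson split_list)
      thus ?thesis using xs path_edges_append[of us z vs]
        by (intro exI[of _ "us @ [z]"]) (auto simp: hd_append)
    next
      case False
      obtain ws where "xs = ws @ [y]" using xs(2,4) by (metis append_butlast_last_id)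
      hence "path_edges (xs @ [z]) = path_edges xs \<union> {{y, z}}"
        using path_edges_append[of ws y "[z]"] by simp
      thus ?thesis using xs False step(2) by (intro exI[of _ "xs @ [z]"]) auto
    qed
  qed
  thus thesis using that by blast
qed

text \<open>As a set of edges a cycle has neither a starting point nor an orientation;
  \<open>cycle_split\<close> recovers vertex lists from any two chosen vertices. The repeated x at
  the end of the list supplies the closing edge.\<close>

definition cycle_edges :: "'a set set \<Rightarrow> 'a set set \<Rightarrow> bool" where
  "cycle_edges E F \<longleftrightarrow>
     (\<exists>x ys. distinct (x # ys) \<and> 2 \<le> length ys \<and> F = path_edges (x # ys @ [x]) \<and> F \<subseteq> E)"

text \<open>A common edge could only join a and b and would then be the whole of both paths, but one
  of them has an inner vertex.\<close>

lemma two_paths_disjoint: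
  assumes "distinct (a # as @ b # bs)" "as \<noteq> [] \<or> bs \<noteq> []"
  shows "path_edges (a # as @ [b]) \<inter> path_edges (b # bs @ [a]) = {}"
proof -
  have False if e: "e \<in> path_edges (a # as @ [b])" "e \<in> path_edges (b # bs @ [a])" for e
  proof -
    have "e \<subseteq> {a, b}"
      using path_edges_subset[OF e(1)] path_edges_subset[OF e(2)] assms(1) by auto
    moreover have "card e = 2" using path_edges_card_2[OF _ e(1)] assms(1) by auto
    ultimately have e': "e = {a, b}"
      by (metis assms(1) card_2_iff card_subset_eq distinct.simps(2) finite.emptyI finite.insertI
          in_set_conv_decomp)
    have "length (a # as @ [b]) = 2"
      by (rule ends_path_edges) (use assms(1) e e' in auto)
    moreover have "length (b # bs @ [a]) = 2"
      by (rule ends_path_edges) (use assms(1) e e' in \<open>auto simp: insert_commute\<close>)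
    ultimately show False using assms(2) by simp
  qed
  thus ?thesis by blast
qed

lemma card_two_paths:
  assumes "distinct (a # as @ b # bs)" "as \<noteq> [] \<or> bs \<noteq> []"
  shows "card (path_edges (a # as @ [b]) \<union> path_edges (b # bs @ [a])) = length as + length bs + 2"
proof -
  have "card (path_edges (a # as @ [b])) = length as + 1" "card (path_edges (b # bs @ [a])) = length bs + 1"
    using assms(1) by (subst card_path_edges; auto)+
  thus ?thesis using two_paths_disjoint[OF assms] by (simp add: card_Un_disjoint)
qed

lemma cycle_join:
  assumes "distinct (a # as @ b # bs)" "as \<noteq> [] \<or> bs \<noteq> []"
    "path_edges (a # as @ [b]) \<subseteq> E" "path_edges (b # bs @ [a]) \<subseteq> E"
  shows "cycle_edges E (path_edges (a # as @ [b]) \<union> path_edges (b # bs @ [a]))"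
proof -
  have "path_edges (a # (as @ b # bs) @ [a]) = path_edges (a # as @ [b]) \<union> path_edges (b # bs @ [a])"
    using path_edges_append[of "a # as" b "bs @ [a]"] by simp
  moreover have "2 \<le> length (as @ b # bs)" using assms(2) by (cases as; cases bs) auto
  ultimately show ?thesis
    unfolding cycle_edges_def using assms by (intro exI[of _ a] exI[of _ "as @ b # bs"]) auto
qed

lemma cycle_rotate_to:
  assumes "distinct (x # ys)" "a \<in> set (x # ys)"
  obtains zs where "distinct (a # zs)" "set (a # zs) = set (x # ys)" "length zs = length ys"
    "path_edges (a # zs @ [a]) = path_edges (x # ys @ [x])"
proof (cases "a = x")
  case True
  thus thesis using that assms by blast
next
  case False
  then obtain us vs where ys: "ys = us @ a # vs" using assms(2) by (auto dest: split_list)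
  have 1: "path_edges (a # (vs @ x # us) @ [a]) = path_edges (a # vs @ [x]) \<union> path_edges (x # us @ [a])"
    using path_edges_append[of "a # vs" x "us @ [a]"] by simp
  have 2: "path_edges (x # ys @ [x]) = path_edges (x # us @ [a]) \<union> path_edges (a # vs @ [x])"
    using path_edges_append[of "x # us" a "vs @ [x]"] ys by simp
  show thesis
    by (rule that[of "vs @ x # us"]) (use assms ys 1 2 in auto)
qed

text \<open>Two internally disjoint paths between chosen vertices are the form in which a cycle
  enters a theta curve.\<close>

lemma cycle_split:
  assumes "cycle_edges E F" "a \<in> \<Union>F" "b \<in> \<Union>F" "a \<noteq> b"
  obtains as bs where "distinct (a # as @ b # bs)" "as \<noteq> [] \<or> bs \<noteq> []"
    "F = path_edges (a # as @ [b]) \<union> path_edges (b # bs @ [a])" "set (a # as @ b # bs) = \<Union>F"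
proof -
  obtain x ys where xs: "distinct (x # ys)" "2 \<le> length ys" "F = path_edges (x # ys @ [x])"
    using assms(1) by (auto simp: cycle_edges_def)
  have U: "\<Union>F = set (x # ys)" unfolding xs(3) by (subst Union_path_edges) auto
  then obtain zs where zs: "distinct (a # zs)" "set (a # zs) = set (x # ys)" "length zs = length ys"
    "path_edges (a # zs @ [a]) = path_edges (x # ys @ [x])"
    using cycle_rotate_to[OF xs(1), of a] assms(2) by metis
  have "b \<in> set zs" using zs(2) U assms(3,4) by auto
  then obtain as bs where s: "zs = as @ b # bs" by (meson split_list)
  show thesis
  proof (rule that[of as bs])
    show "distinct (a # as @ b # bs)" using zs(1) s by simp
    show "as \<noteq> [] \<or> bs \<noteq> []" using zs(3) xs(2) s by auto
    show "F = path_edges (a # as @ [b]) \<union> path_edges (b # bs @ [a])"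
      using zs(4) xs(3) s path_edges_append[of "a # as" b "bs @ [a]"] by simp
    show "set (a # as @ b # bs) = \<Union>F" using zs(2) U s by simp
  qed
qed

lemma cycle_edges_subset: "cycle_edges E F \<Longrightarrow> F \<subseteq> E"
  by (auto simp: cycle_edges_def)

lemma cycle_two_vertices:
  assumes "cycle_edges E F"
  obtains a b where "a \<in> \<Union>F" "b \<in> \<Union>F" "a \<noteq> b"
proof -
  obtain x ys where xs: "distinct (x # ys)" "2 \<le> length ys" "F = path_edges (x # ys @ [x])"
    using assms by (auto simp: cycle_edges_def)
  have "\<Union>F = set (x # ys)" unfolding xs(3) by (subst Union_path_edges) auto
  thus thesis using that[of x "hd ys"] xs by (cases ys) auto
qed

lemma card_cycle_vertices:
  assumes "cycle_edges E F"
  shows "card (\<Union>F) = card F" "3 \<le> card F" "finite (\<Union>F)"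
proof -
  obtain a b where ab: "a \<in> \<Union>F" "b \<in> \<Union>F" "a \<noteq> b" using cycle_two_vertices[OF assms] .
  obtain as bs where s: "distinct (a # as @ b # bs)" "as \<noteq> [] \<or> bs \<noteq> []"
    "F = path_edges (a # as @ [b]) \<union> path_edges (b # bs @ [a])" "set (a # as @ b # bs) = \<Union>F"
    using cycle_split[OF assms ab] by metis
  have "card (\<Union>F) = length (a # as @ b # bs)" using s(1,4) distinct_card by metis
  thus "card (\<Union>F) = card F" using card_two_paths[OF s(1,2)] s(3) by simp
  show "3 \<le> card F" using card_two_paths[OF s(1,2)] s(2,3) by (cases as; cases bs) auto
  show "finite (\<Union>F)" using s(4) by (metis List.finite_set)
qed

section \<open>Cycles in plane drawings\<close>

lemma connected_inside_or_outside:
  fixes S :: "complex set"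
  assumes "closed J" "connected S" "S \<inter> J = {}"
  shows "S \<subseteq> inside J \<or> S \<subseteq> outside J"
proof -
  have "S \<subseteq> inside J \<union> outside J" using assms(3) by (auto simp: inside_Un_outside)
  moreover have "inside J \<inter> outside J \<inter> S = {}" by simp
  ultimately have "inside J \<inter> S = {} \<or> outside J \<inter> S = {}"
    using connectedD[OF assms(2) open_inside[OF assms(1)] open_outside[OF assms(1)]] by blast
  thus ?thesis using \<open>S \<subseteq> inside J \<union> outside J\<close> by blast
qed

locale plane_graph =
  fixes V :: "'a set" and E :: "'a set set" and p :: "'a \<Rightarrow> complex" and \<gamma> :: "'a set \<Rightarrow> real \<Rightarrow> complex"
  assumes simple: "simple_graph V E" and drawing: "plane_drawing V E p \<gamma>"
begin

definition drawn where "drawn F = (\<Union>e\<in>F. path_image (\<gamma> e))"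

text \<open>Without its ends, an edge that starts or ends on a cycle still lies on one definite side
  of it.\<close>

definition open_edge where "open_edge e = path_image (\<gamma> e) - p ` e"

lemma finV: "finite V" and edge_subset: "e \<in> E \<Longrightarrow> e \<subseteq> V" and edge_card: "e \<in> E \<Longrightarrow> card e = 2"
  using simple by (auto simp: simple_graph_def)

lemma finE: "finite E"
  using finV edge_subset by (intro finite_subset[of E "Pow V"]) auto

lemma inj_p: "inj_on p V"
  and edge_arc: "e \<in> E \<Longrightarrow> arc (\<gamma> e)"
  and edge_ends: "e \<in> E \<Longrightarrow> {pathstart (\<gamma> e), pathfinish (\<gamma> e)} = p ` e"
  and edge_vertices: "e \<in> E \<Longrightarrow> path_image (\<gamma> e) \<inter> p ` V = p ` e"
  and edges_meet: "e \<in> E \<Longrightarrow> e' \<in> E \<Longrightarrow> e \<noteq> e' \<Longrightarrow>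
    path_image (\<gamma> e) \<inter> path_image (\<gamma> e') \<subseteq> p ` (e \<inter> e')"
  using drawing by (auto simp: plane_drawing_def)

lemma edge_ends_drawn: "e \<in> E \<Longrightarrow> p ` e \<subseteq> path_image (\<gamma> e)"
  using edge_vertices by blast

lemma drawn_Un: "drawn (F \<union> F') = drawn F \<union> drawn F'"
  by (auto simp: drawn_def)

lemma drawn_Int:
  assumes "F \<subseteq> E" "F' \<subseteq> E" "F \<inter> F' = {}"
  shows "drawn F \<inter> drawn F' \<subseteq> p ` (\<Union>F \<inter> \<Union>F')"
proof
  fix z assume "z \<in> drawn F \<inter> drawn F'"
  then obtain e e' where e: "e \<in> F" "e' \<in> F'" "z \<in> path_image (\<gamma> e) \<inter> path_image (\<gamma> e')"
    by (auto simp: drawn_def)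
  moreover have "e \<noteq> e'" using e assms(3) by blast
  ultimately have "z \<in> p ` (e \<inter> e')" using edges_meet[of e e'] assms(1,2) by blast
  thus "z \<in> p ` (\<Union>F \<inter> \<Union>F')" using e by blast
qed

lemma vertex_drawn_iff:
  assumes "v \<in> V" "F \<subseteq> E"
  shows "p v \<in> drawn F \<longleftrightarrow> v \<in> \<Union>F"
proof
  assume "p v \<in> drawn F"
  then obtain e where e: "e \<in> F" "p v \<in> path_image (\<gamma> e)" by (auto simp: drawn_def)
  hence "p v \<in> p ` e" using edge_vertices[of e] assms by blast
  moreover have "e \<subseteq> V" using edge_subset e(1) assms(2) by blast
  ultimately have "v \<in> e" using inj_on_image_mem_iff[OF inj_p assms(1)] by blast
  thus "v \<in> \<Union>F" using e(1) by blast
next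
  assume "v \<in> \<Union>F"
  then obtain e where "e \<in> F" "v \<in> e" by blast
  thus "p v \<in> drawn F" using edge_ends_drawn[of e] assms(2) unfolding drawn_def by blast
qed

lemma open_edge_drawn:
  assumes "e \<in> E" "F \<subseteq> E" "e \<notin> F"
  shows "open_edge e \<inter> drawn F = {}"
  using edges_meet[of e] assms unfolding open_edge_def drawn_def by blast

lemma open_edge_path: "e \<in> E \<Longrightarrow> open_edge e = path_image (\<gamma> e) - {pathstart (\<gamma> e), pathfinish (\<gamma> e)}"
  using edge_ends by (simp add: open_edge_def)

lemma open_edge_connected: "e \<in> E \<Longrightarrow> connected (open_edge e)"
  and open_edge_nonempty: "e \<in> E \<Longrightarrow> open_edge e \<noteq> {}"
  using open_edge_path connected_simple_path_endless nonempty_simple_path_endless edge_arc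
    arc_imp_simple_path by metis+

lemma closed_drawn:
  assumes "F \<subseteq> E"
  shows "closed (drawn F)"
proof -
  have "compact (path_image (\<gamma> e))" if "e \<in> F" for e
    using edge_arc[of e] that assms by (auto intro: compact_path_image arc_imp_path)
  moreover have "finite F" using assms finE finite_subset by blast
  ultimately show ?thesis unfolding drawn_def by (intro closed_UN) (auto intro: compact_imp_closed)
qed

text \<open>Lets \<open>inner_edge_end\<close> carry the side of an open edge over to its
  ends.\<close>

lemma drawn_image_in_closure:
  assumes "e \<in> E"
  shows "path_image (\<gamma> e) \<subseteq> closure (open_edge e)"
proof -
  have "open_edge e = \<gamma> e ` {0<..<1}"
    using simple_path_endless[OF arc_imp_simple_path[OF edge_arc[OF assms]]] open_edge_path[OF assms] by simp
  moreover have "continuous_on (closure {0<..<1}) (\<gamma> e)"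
    using arc_imp_path[OF edge_arc[OF assms]] by (simp add: path_def)
  hence "\<gamma> e ` closure {0<..<1} \<subseteq> closure (\<gamma> e ` {0<..<1})"
    by (rule image_closure_subset) (auto simp: closure_subset)
  ultimately show ?thesis by (simp add: path_image_def)
qed

lemma edge_from_to:
  assumes "{x, y} \<in> E"
  obtains g where "arc g" "pathstart g = p x" "pathfinish g = p y" "path_image g = path_image (\<gamma> {x, y})"
proof -
  have "{pathstart (\<gamma> {x, y}), pathfinish (\<gamma> {x, y})} = {p x, p y}" using edge_ends[OF assms] by simp
  hence "pathstart (\<gamma> {x, y}) = p x \<and> pathfinish (\<gamma> {x, y}) = p y \<or>
      pathstart (\<gamma> {x, y}) = p y \<and> pathfinish (\<gamma> {x, y}) = p x"
    by (auto simp: doubleton_eq_iff)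
  thus thesis
    using that[of "\<gamma> {x, y}"] that[of "reversepath (\<gamma> {x, y})"] edge_arc[OF assms]
    by (auto simp: arc_reversepath)
qed

text \<open>The first edge meets the rest of the path only in \<open>p y\<close>, because edges
  share only common ends and x does not recur; so the join remains an arc.\<close>

lemma path_arc:
  assumes "distinct xs" "2 \<le> length xs" "path_edges xs \<subseteq> E"
  obtains g where "arc g" "pathstart g = p (hd xs)" "pathfinish g = p (last xs)"
    "path_image g = drawn (path_edges xs)"
proof -
  have "\<exists>g. arc g \<and> pathstart g = p (hd xs) \<and> pathfinish g = p (last xs)
      \<and> path_image g = drawn (path_edges xs)"
    using assms
  proof (induction xs rule: path_edges.induct)
    case (1 x y zs)
    obtain g where g: "arc g" "pathstart g = p x" "pathfinish g = p y" "path_image g = path_image (\<gamma> {x, y})"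
      using edge_from_to[of x y] 1 by auto
    show ?case
    proof (cases zs)
      case Nil
      thus ?thesis using g by (intro exI[of _ g]) (auto simp: drawn_def)
    next
      case (Cons z zs')
      then obtain h where h: "arc h" "pathstart h = p y" "pathfinish h = p (last (y # zs))"
        "path_image h = drawn (path_edges (y # zs))"
        using 1 by auto
      have n: "{x, y} \<notin> path_edges (y # zs)"
        using path_edges_subset[of "{x, y}" "y # zs"] 1(2) by auto
      have "path_image g = drawn {{x, y}}" using g by (simp add: drawn_def)
      hence "path_image g \<inter> path_image h \<subseteq> p ` (\<Union>{{x, y}} \<inter> \<Union>(path_edges (y # zs)))"
        using drawn_Int[of "{{x, y}}" "path_edges (y # zs)"] n 1(4) h by auto
      also have "\<Union>(path_edges (y # zs)) = set (y # zs)" using Cons by (subst Union_path_edges) auto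
      finally have "path_image g \<inter> path_image h \<subseteq> {p y}" using 1(2) by auto
      hence "arc (g +++ h)" using arc_join[OF g(1) h(1)] g h by simp
      moreover have "path_image (g +++ h) = drawn (path_edges (x # y # zs))"
        using g h by (simp add: path_image_join drawn_def)
      ultimately show ?thesis using g h by (intro exI[of _ "g +++ h"]) auto
    qed
  qed auto
  thus thesis using that by blast
qed

lemma two_paths_arcs:
  assumes s: "distinct (a # as @ b # bs)" "as \<noteq> [] \<or> bs \<noteq> []"
    "path_edges (a # as @ [b]) \<subseteq> E" "path_edges (b # bs @ [a]) \<subseteq> E"
  obtains c1 c2 where "arc c1" "pathstart c1 = p a" "pathfinish c1 = p b"
    "arc c2" "pathstart c2 = p a" "pathfinish c2 = p b"
    "path_image c1 = drawn (path_edges (a # as @ [b]))"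
    "path_image c2 = drawn (path_edges (b # bs @ [a]))"
    "path_image c1 \<inter> path_image c2 = {p a, p b}"
proof -
  obtain c1 where c1: "arc c1" "pathstart c1 = p a" "pathfinish c1 = p b"
    "path_image c1 = drawn (path_edges (a # as @ [b]))"
    using path_arc[of "a # as @ [b]"] s by auto
  obtain c where c: "arc c" "pathstart c = p b" "pathfinish c = p a"
    "path_image c = drawn (path_edges (b # bs @ [a]))"
    using path_arc[of "b # bs @ [a]"] s by auto
  have "path_image c1 \<inter> path_image c \<subseteq>
      p ` (\<Union>(path_edges (a # as @ [b])) \<inter> \<Union>(path_edges (b # bs @ [a])))"
    unfolding c1(4) c(4) by (intro drawn_Int s two_paths_disjoint)
  also have "\<Union>(path_edges (a # as @ [b])) = set (a # as @ [b])" by (subst Union_path_edges) auto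
  also have "\<Union>(path_edges (b # bs @ [a])) = set (b # bs @ [a])" by (subst Union_path_edges) auto
  also have "set (a # as @ [b]) \<inter> set (b # bs @ [a]) = {a, b}" using s(1) by auto
  finally have "path_image c1 \<inter> path_image c \<subseteq> {p a, p b}" by simp
  moreover have "{p a, p b} \<subseteq> path_image c1 \<inter> path_image c"
    using pathstart_in_path_image[of c1] pathfinish_in_path_image[of c1]
      pathstart_in_path_image[of c] pathfinish_in_path_image[of c] c1 c by auto
  ultimately have "path_image c1 \<inter> path_image c = {p a, p b}" by blast
  thus thesis using that[of c1 "reversepath c"] c1 c by (simp add: arc_reversepath)
qed

lemma cycle_loop:
  assumes "cycle_edges E F"
  obtains c where "simple_path c" "pathfinish c = pathstart c" "path_image c = drawn F"
proof -
  obtain a b where ab: "a \<in> \<Union>F" "b \<in> \<Union>F" "a \<noteq> b" using cycle_two_vertices[OF assms] .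
  obtain as bs where s: "distinct (a # as @ b # bs)" "as \<noteq> [] \<or> bs \<noteq> []"
    "F = path_edges (a # as @ [b]) \<union> path_edges (b # bs @ [a])"
    using cycle_split[OF assms ab] by metis
  have sE: "path_edges (a # as @ [b]) \<subseteq> E" "path_edges (b # bs @ [a]) \<subseteq> E"
    using cycle_edges_subset[OF assms] s(3) by auto
  obtain c1 c2 where c: "arc c1" "pathstart c1 = p a" "pathfinish c1 = p b"
    "arc c2" "pathstart c2 = p a" "pathfinish c2 = p b"
    "path_image c1 = drawn (path_edges (a # as @ [b]))"
    "path_image c2 = drawn (path_edges (b # bs @ [a]))"
    "path_image c1 \<inter> path_image c2 = {p a, p b}"
    using two_paths_arcs[OF s(1,2) sE] by blast
  have "simple_path (c1 +++ reversepath c2)"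
    using c by (intro simple_path_join_loop) (auto simp: arc_reversepath)
  thus thesis
    using that[of "c1 +++ reversepath c2"] c s(3) by (simp add: path_image_join drawn_Un)
qed

section \<open>Edges and vertices inside a cycle\<close>

definition inner_edges where "inner_edges F = {e \<in> E. open_edge e \<subseteq> inside (drawn F)}"

definition inner_vertices where "inner_vertices F = {v \<in> V. p v \<in> inside (drawn F)}"

lemma finite_inner: "finite (inner_edges F)" "finite (inner_vertices F)"
  using finE finV by (auto simp: inner_edges_def inner_vertices_def)

lemma inner_edges_disjoint: "F \<subseteq> E \<Longrightarrow> inner_edges F \<inter> F = {}"
proof -
  assume "F \<subseteq> E"
  have False if e: "e \<in> inner_edges F" "e \<in> F" for e
  proof -
    obtain z where z: "z \<in> open_edge e" using open_edge_nonempty[of e] e by (auto simp: inner_edges_def)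
    hence "z \<in> drawn F" using e(2) by (auto simp: open_edge_def drawn_def)
    moreover have "z \<in> inside (drawn F)" using z e(1) by (auto simp: inner_edges_def)
    ultimately show False using inside_no_overlap by blast
  qed
  thus ?thesis by blast
qed

lemma inner_vertices_disjoint:
  assumes "F \<subseteq> E"
  shows "inner_vertices F \<inter> \<Union>F = {}"
proof -
  have False if "v \<in> inner_vertices F" "v \<in> \<Union>F" for v
    using that vertex_drawn_iff[OF _ assms, of v] inside_no_overlap[of "drawn F"]
    unfolding inner_vertices_def by blast
  thus ?thesis by blast
qed

lemma edge_inner_or_outer:
  assumes "F \<subseteq> E" "e \<in> E" "e \<notin> F"
  shows "e \<in> inner_edges F \<or> open_edge e \<subseteq> outside (drawn F)"
  using connected_inside_or_outside[OF closed_drawn[OF assms(1)] open_edge_connected[OF assms(2)]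
      open_edge_drawn[OF assms(2,1,3)]] assms(2) by (auto simp: inner_edges_def)

text \<open>Neither end is on F, so the whole arc misses the cycle and, being connected, stays on
  one side.\<close>

lemma neighbor_inner:
  assumes F: "F \<subseteq> E" and e: "{x, y} \<in> E" and x: "x \<in> inner_vertices F" and y: "y \<notin> \<Union>F"
  shows "y \<in> inner_vertices F"
proof -
  have xF: "x \<notin> \<Union>F" using inner_vertices_disjoint[OF F] x by blast
  have "path_image (\<gamma> {x, y}) \<inter> drawn F = {}"
  proof -
    have "{x, y} \<notin> F" using y by blast
    hence "drawn {{x, y}} \<inter> drawn F \<subseteq> p ` (\<Union>{{x, y}} \<inter> \<Union>F)"
      using F e by (intro drawn_Int) auto
    also have "\<Union>{{x, y}} \<inter> \<Union>F = {}" using y xF by blast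
    finally show ?thesis by (simp add: drawn_def)
  qed
  hence "path_image (\<gamma> {x, y}) \<subseteq> inside (drawn F) \<or> path_image (\<gamma> {x, y}) \<subseteq> outside (drawn F)"
    using connected_inside_or_outside[OF closed_drawn[OF F]]
      connected_path_image[OF arc_imp_path[OF edge_arc[OF e]]] by blast
  moreover have "p x \<in> path_image (\<gamma> {x, y})" "p y \<in> path_image (\<gamma> {x, y})"
    using edge_ends_drawn[OF e] by auto
  moreover have "p x \<in> inside (drawn F)" using x by (simp add: inner_vertices_def)
  moreover have "inside (drawn F) \<inter> outside (drawn F) = {}" by simp
  ultimately have "p y \<in> inside (drawn F)" by blast
  moreover have "y \<in> V" using edge_subset[OF e] by simp
  ultimately show ?thesis by (simp add: inner_vertices_def)
qed

text \<open>The outside is open, so an end lying there would have points of the open edge around it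
  outside as well.\<close>

lemma inner_edge_end:
  assumes F: "F \<subseteq> E" and e: "e \<in> inner_edges F" "w \<in> e" "w \<notin> \<Union>F"
  shows "w \<in> inner_vertices F"
proof -
  have eE: "e \<in> E" "open_edge e \<subseteq> inside (drawn F)" using e(1) by (auto simp: inner_edges_def)
  have wV: "w \<in> V" using edge_subset[OF eE(1)] e(2) by blast
  have "p w \<notin> drawn F" using vertex_drawn_iff[OF wV F] e(3) by blast
  moreover have "p w \<notin> outside (drawn F)"
  proof
    assume "p w \<in> outside (drawn F)"
    moreover have "p w \<in> closure (open_edge e)"
      using drawn_image_in_closure[OF eE(1)] edge_ends_drawn[OF eE(1)] e(2) by blast
    ultimately have "outside (drawn F) \<inter> open_edge e \<noteq> {}"
      using open_Int_closure_eq_empty[OF open_outside[OF closed_drawn[OF F]]] by blast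
    thus False using eE(2) inside_Int_outside[of "drawn F"] by blast
  qed
  ultimately have "p w \<in> inside (drawn F)" using inside_Un_outside[of "drawn F"] by blast
  thus ?thesis using wV by (simp add: inner_vertices_def)
qed

end

section \<open>Splitting the inside of a cycle along a path\<close>

context plane_graph
begin

text \<open>Three arcs from a to b that meet pairwise only in their ends form a theta curve, to
  which \<open>split_inside_simple_closed_curve\<close> applies. The count of edges holds because
  each new cycle contains the whole ear.\<close>

lemma theta_split:
  assumes s: "distinct (a # as @ b # bs)" "as \<noteq> [] \<or> bs \<noteq> []"
    and F: "F = path_edges (a # as @ [b]) \<union> path_edges (b # bs @ [a])" "F \<subseteq> E"
    and ear: "distinct (a # cs @ [b])" "set cs \<inter> \<Union>F = {}" "path_edges (a # cs @ [b]) \<subseteq> E"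
      "path_edges (a # cs @ [b]) \<inter> F = {}" "drawn (path_edges (a # cs @ [b])) \<inter> inside (drawn F) \<noteq> {}"
    and C: "C1 = path_edges (a # as @ [b]) \<union> path_edges (a # cs @ [b])"
      "C2 = path_edges (b # bs @ [a]) \<union> path_edges (a # cs @ [b])"
  shows "cycle_edges E C1" "cycle_edges E C2"
    "card C1 + card C2 = card F + 2 * Suc (length cs)"
    "inside (drawn C1) \<inter> inside (drawn C2) = {}"
    "inside (drawn C1) \<union> inside (drawn C2) \<union> (drawn (path_edges (a # cs @ [b])) - {p a, p b})
      = inside (drawn F)"
proof -
  let ?P1 = "path_edges (a # as @ [b])" and ?P2 = "path_edges (b # bs @ [a])"
    and ?Q = "path_edges (a # cs @ [b])"
  have UF: "\<Union>F = set (a # as @ b # bs)"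
  proof -
    have "\<Union>?P1 = set (a # as @ [b])" "\<Union>?P2 = set (b # bs @ [a])"
      by (subst Union_path_edges; auto)+
    thus ?thesis unfolding F(1) by auto
  qed
  \<comment> \<open>A cycle runs from a to b and back, so in C1 and C2 the ear is traversed
    backwards, and in C2 the second path of F as well.\<close>
  have rev_Q: "path_edges (b # rev cs @ [a]) = ?Q"
    using path_edges_rev[of "a # cs @ [b]"] by simp
  have rev_P2: "path_edges (a # rev bs @ [b]) = ?P2"
    using path_edges_rev[of "b # bs @ [a]"] by simp
  have cs: "set cs \<inter> set as = {}" "set cs \<inter> set bs = {}" using ear(2) UF by auto
  have d1: "distinct (a # as @ b # rev cs)" and d2: "distinct (a # rev bs @ b # rev cs)"
    using s(1) ear(1) cs by auto
  \<comment> \<open>If both paths were single edges, the ear would be the edge from a to b that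
    already belongs to F.\<close>
  have ne1: "as \<noteq> [] \<or> rev cs \<noteq> []"
  proof (rule ccontr)
    assume "\<not> ?thesis"
    hence "?P1 \<subseteq> ?Q" "?P1 \<noteq> {}" by auto
    thus False using ear(4) F(1) by blast
  qed
  have ne2: "rev bs \<noteq> [] \<or> rev cs \<noteq> []"
  proof (rule ccontr)
    assume "\<not> ?thesis"
    hence "?P2 \<subseteq> ?Q" "?P2 \<noteq> {}" by (auto simp: insert_commute)
    thus False using ear(4) F(1) by blast
  qed
  have PE: "?P1 \<subseteq> E" "?P2 \<subseteq> E" using F by auto
  show "cycle_edges E C1"
    using cycle_join[OF d1 ne1 PE(1)] rev_Q ear(3) C(1) by simp
  show "cycle_edges E C2"
    using cycle_join[OF d2 ne2] PE(2) rev_P2 rev_Q ear(3) C(2) by simp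
  have "card C1 = length as + length cs + 2"
    using card_two_paths[OF d1 ne1] rev_Q C(1) by simp
  moreover have "card C2 = length bs + length cs + 2"
    using card_two_paths[OF d2 ne2] rev_Q rev_P2 C(2) by simp
  moreover have "card F = length as + length bs + 2"
    using card_two_paths[OF s(1,2)] F(1) by simp
  ultimately show "card C1 + card C2 = card F + 2 * Suc (length cs)" by simp
  obtain c1 c2 where c12: "arc c1" "pathstart c1 = p a" "pathfinish c1 = p b"
    "arc c2" "pathstart c2 = p a" "pathfinish c2 = p b"
    "path_image c1 = drawn ?P1" "path_image c2 = drawn ?P2"
    "path_image c1 \<inter> path_image c2 = {p a, p b}"
    using two_paths_arcs[OF s(1,2) PE] by blast
  obtain c where c: "arc c" "pathstart c = p a" "pathfinish c = p b" "path_image c = drawn ?Q"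
    using path_arc[of "a # cs @ [b]"] ear by auto
  \<comment> \<open>The arcs delivered by \<open>two_paths_arcs\<close> are new ones, but the claim
    concerns only their images, which are the same drawn sets.\<close>
  have Q1: "path_image c1 \<inter> path_image c = {p a, p b}"
    by (rule two_paths_arcs[OF d1 ne1 PE(1)]) (use rev_Q ear(3) c12 c in auto)
  have Q2: "path_image c2 \<inter> path_image c = {p a, p b}"
    by (rule two_paths_arcs[OF d2 ne2]) (use rev_Q rev_P2 PE(2) ear(3) c12 c in auto)
  have ne: "p a \<noteq> p b" using arc_distinct_ends[OF c(1)] c by simp
  have meets: "path_image c \<inter> inside (path_image c1 \<union> path_image c2) \<noteq> {}"
    using ear(5) c c12 F(1) by (simp add: drawn_Un)
  note theta = split_inside_simple_closed_curve[OF arc_imp_simple_path[OF c12(1)] c12(2,3)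
      arc_imp_simple_path[OF c12(4)] c12(5,6) arc_imp_simple_path[OF c(1)] c(2,3) ne c12(9) Q1 Q2 meets]
  show "inside (drawn C1) \<inter> inside (drawn C2) = {}"
    by (rule theta) (simp add: C drawn_Un c12 c)
  show "inside (drawn C1) \<union> inside (drawn C2) \<union> (drawn ?Q - {p a, p b}) = inside (drawn F)"
    by (rule theta) (simp add: C F(1) drawn_Un c12 c)
qed

text \<open>The counts are one-sided, in the direction that \<open>inner_bound\<close> needs. The
  strict decrease is due to the ear, whose edges are inside F but lie on both C1 and C2.\<close>

lemma ear_split:
  assumes F: "cycle_edges E F" and ab: "a \<in> \<Union>F" "b \<in> \<Union>F" "a \<noteq> b"
    and ear: "distinct (a # cs @ [b])" "set cs \<inter> \<Union>F = {}" "path_edges (a # cs @ [b]) \<subseteq> E"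
      "path_edges (a # cs @ [b]) \<inter> F = {}" "drawn (path_edges (a # cs @ [b])) \<inter> inside (drawn F) \<noteq> {}"
  obtains C1 C2 where "cycle_edges E C1" "cycle_edges E C2"
    "card C1 + card C2 = card F + 2 * Suc (length cs)"
    "card (inner_edges C1) < card (inner_edges F)" "card (inner_edges C2) < card (inner_edges F)"
    "card (inner_edges F) \<le> card (inner_edges C1) + card (inner_edges C2) + Suc (length cs)"
    "card (inner_vertices C1) + card (inner_vertices C2) + length cs \<le> card (inner_vertices F)"
proof -
  let ?Q = "path_edges (a # cs @ [b])"
  obtain as bs where s: "distinct (a # as @ b # bs)" "as \<noteq> [] \<or> bs \<noteq> []"
    "F = path_edges (a # as @ [b]) \<union> path_edges (b # bs @ [a])"
    using cycle_split[OF F ab] by metis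
  have FE: "F \<subseteq> E" using cycle_edges_subset[OF F] .
  define C1 where "C1 = path_edges (a # as @ [b]) \<union> ?Q"
  define C2 where "C2 = path_edges (b # bs @ [a]) \<union> ?Q"
  note t = theta_split[OF s FE ear C1_def C2_def]
  have CE: "C1 \<subseteq> E" "C2 \<subseteq> E" using t(1,2) cycle_edges_subset by auto
  have QC: "?Q \<subseteq> C1" "?Q \<subseteq> C2" by (auto simp: C1_def C2_def)
  have Q_ne: "?Q \<noteq> {}" by (cases cs) auto
  have UQ: "\<Union>?Q = set (a # cs @ [b])" by (subst Union_path_edges) auto
  have Q_inner: "?Q \<subseteq> inner_edges F"
  proof
    fix e assume e: "e \<in> ?Q"
    hence eE: "e \<in> E" using ear(3) by blast
    have "open_edge e \<inter> {p a, p b} = {}"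
    proof -
      have "p v \<notin> open_edge e" if "v \<in> {a, b}" for v
      proof
        assume v: "p v \<in> open_edge e"
        have "{a, b} \<subseteq> V" using UQ ear(3) edge_subset by fastforce
        hence "p v \<in> p ` e" using edge_vertices[OF eE] v that by (auto simp: open_edge_def)
        thus False using v by (simp add: open_edge_def)
      qed
      thus ?thesis by blast
    qed
    moreover have "open_edge e \<subseteq> drawn ?Q" using e by (auto simp: open_edge_def drawn_def)
    ultimately have "open_edge e \<subseteq> inside (drawn F)" using t(5) by blast
    thus "e \<in> inner_edges F" using eE by (simp add: inner_edges_def)
  qed
  have sub: "inner_edges C1 \<subseteq> inner_edges F" "inner_edges C2 \<subseteq> inner_edges F"
    using t(5) by (auto simp: inner_edges_def)
  have proper: "inner_edges C1 \<subset> inner_edges F" "inner_edges C2 \<subset> inner_edges F"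
    using sub Q_inner Q_ne QC inner_edges_disjoint[OF CE(1)] inner_edges_disjoint[OF CE(2)] by blast+
  \<comment> \<open>An edge that is off the ear and outside both new cycles would miss all three
    pieces that make up the inside of F.\<close>
  have cover: "inner_edges F \<subseteq> inner_edges C1 \<union> inner_edges C2 \<union> ?Q"
  proof
    fix e assume e: "e \<in> inner_edges F"
    hence eE: "e \<in> E" "open_edge e \<subseteq> inside (drawn F)" by (auto simp: inner_edges_def)
    show "e \<in> inner_edges C1 \<union> inner_edges C2 \<union> ?Q"
    proof (rule ccontr)
      assume n: "\<not> ?thesis"
      have nF: "e \<notin> F" using e inner_edges_disjoint[OF FE] by blast
      have "e \<notin> C1" "e \<notin> C2" using n nF s(3) by (auto simp: C1_def C2_def)
      hence "open_edge e \<subseteq> outside (drawn C1)" "open_edge e \<subseteq> outside (drawn C2)"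
        using edge_inner_or_outer[OF CE(1) eE(1)] edge_inner_or_outer[OF CE(2) eE(1)] n by blast+
      moreover have "open_edge e \<inter> drawn ?Q = {}"
        using open_edge_drawn[OF eE(1) ear(3)] n by blast
      ultimately have "open_edge e \<inter> inside (drawn F) = {}"
        unfolding t(5)[symmetric]
        using inside_Int_outside[of "drawn C1"] inside_Int_outside[of "drawn C2"] by blast
      thus False using eE open_edge_nonempty[OF eE(1)] by blast
    qed
  qed
  have card_Q: "card ?Q = Suc (length cs)" using card_path_edges[OF ear(1)] by simp
  have "card (inner_edges F) \<le> card (inner_edges C1 \<union> inner_edges C2 \<union> ?Q)"
    using cover finite_inner by (intro card_mono) auto
  also have "\<dots> \<le> card (inner_edges C1) + card (inner_edges C2) + Suc (length cs)"
    using card_Un_le[of "inner_edges C1 \<union> inner_edges C2" ?Q]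
      card_Un_le[of "inner_edges C1" "inner_edges C2"] card_Q by linarith
  finally have edges: "card (inner_edges F) \<le> \<dots>" .
  have cs_V: "set cs \<subseteq> V" using UQ ear(3) edge_subset by fastforce
  have cs_drawn: "p ` set cs \<subseteq> drawn ?Q" 
    using vertex_drawn_iff[OF _ ear(3)] cs_V UQ by auto
  have ab_V: "a \<in> V" "b \<in> V" using ab(1,2) FE edge_subset by blast+
  have "inner_vertices C1 \<inter> set cs = {}" "inner_vertices C2 \<inter> set cs = {}"
    using inner_vertices_disjoint[OF CE(1)] inner_vertices_disjoint[OF CE(2)] QC UQ by fastforce+
  moreover have "inner_vertices C1 \<inter> inner_vertices C2 = {}"
    using t(4) by (auto simp: inner_vertices_def)
  ultimately have "card (inner_vertices C1 \<union> inner_vertices C2 \<union> set cs)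
      = card (inner_vertices C1) + card (inner_vertices C2) + card (set cs)"
    using finite_inner by (subst card_Un_disjoint; auto simp: card_Un_disjoint)
  moreover have "card (set cs) = length cs" using ear(1) by (simp add: distinct_card)
  moreover have "inner_vertices C1 \<union> inner_vertices C2 \<union> set cs \<subseteq> inner_vertices F"
  proof -
    have "p v \<noteq> p a \<and> p v \<noteq> p b" if "v \<in> set cs" for v
      using that ear(1) cs_V ab_V inj_p by (auto simp: inj_on_def)
    hence "p ` set cs \<subseteq> inside (drawn F)" using cs_drawn t(5) by blast
    thus ?thesis using cs_V t(5) by (auto simp: inner_vertices_def)
  qed
  ultimately have vertices:
    "card (inner_vertices C1) + card (inner_vertices C2) + length cs \<le> card (inner_vertices F)"
    using card_mono[OF finite_inner(2)] by metis
  show thesis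
    by (rule that[OF t(1-3) psubset_card_mono[OF finite_inner(1) proper(1)]
          psubset_card_mono[OF finite_inner(1) proper(2)] edges vertices])
qed

end

section \<open>Edge bound for plane graphs of girth at least 12\<close>

text \<open>Essentially 2-connectedness: T plays the role of a cut vertex.\<close>

definition well_linked :: "'a set \<Rightarrow> 'a set set \<Rightarrow> bool" where
  "well_linked V E \<longleftrightarrow>
     (\<forall>K T. K \<noteq> {} \<and> K \<subseteq> V \<and> T \<subseteq> V \<and> K \<inter> T = {} \<and> card T \<le> 1 \<and>
        (\<forall>x\<in>K. \<forall>y. {x, y} \<in> E \<longrightarrow> y \<in> K \<union> T) \<longrightarrow> K \<union> T = V)"

text \<open>Let T be the set of neighbors of K outside K. If T had at most one element, it would
  have to contain all of V - K, which has at least two.\<close>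

lemma well_linked_two_exits:
  assumes wl: "well_linked V E" and V: "finite V" "\<And>e. e \<in> E \<Longrightarrow> e \<subseteq> V"
    and K: "K \<noteq> {}" "K \<subseteq> V" "2 \<le> card (V - K)"
  obtains x y a b where "x \<in> K" "y \<in> K" "a \<in> V - K" "b \<in> V - K" "a \<noteq> b" "{x, a} \<in> E" "{y, b} \<in> E"
proof -
  define T where "T = {a \<in> V - K. \<exists>x\<in>K. {x, a} \<in> E}"
  have T: "T \<subseteq> V" "K \<inter> T = {}" "finite T" using V(1) by (auto simp: T_def)
  have nb: "y \<in> K \<union> T" if "x \<in> K" "{x, y} \<in> E" for x y
    using that V(2)[of "{x, y}"] by (auto simp: T_def)
  have "\<not> card T \<le> 1"
  proof
    assume c: "card T \<le> 1"
    have "\<forall>x\<in>K. \<forall>y. {x, y} \<in> E \<longrightarrow> y \<in> K \<union> T" using nb by simp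
    hence "K \<union> T = V"
      using wl[unfolded well_linked_def, THEN spec, THEN spec, of K T] K(1,2) T(1,2) c by simp
    hence "V - K \<subseteq> T" by blast
    hence "card (V - K) \<le> card T" by (rule card_mono[OF T(3)])
    thus False using K(3) c by linarith
  qed
  then obtain a b where "a \<in> T" "b \<in> T" "a \<noteq> b"
    using T(3) card_le_Suc0_iff_eq by (metis One_nat_def)
  thus thesis using that by (auto simp: T_def)
qed

text \<open>In a longest path all neighbors of the first vertex x lie on the path, and x has at
  least two. One that is not next to x on the path closes a cycle.\<close>

lemma well_linked_cycle:
  assumes wl: "well_linked V E" and V: "simple_graph V E" "3 \<le> card V"
  obtains F where "cycle_edges E F"
proof -
  have fin: "finite V" and sub: "\<And>e. e \<in> E \<Longrightarrow> e \<subseteq> V" and c2: "\<And>e. e \<in> E \<Longrightarrow> card e = 2"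
    using V(1) by (auto simp: simple_graph_def)
  define P where "P xs \<longleftrightarrow> distinct xs \<and> xs \<noteq> [] \<and> set xs \<subseteq> V \<and> path_edges xs \<subseteq> E" for xs
  obtain v where "v \<in> V" using V(2) by fastforce
  hence "P [v]" by (simp add: P_def)
  moreover have "length xs \<le> card V" if "P xs" for xs
    using that card_mono[OF fin, of "set xs"] distinct_card[of xs] by (simp add: P_def)
  ultimately obtain xs where xs: "P xs" "\<And>ys. P ys \<Longrightarrow> length ys \<le> length xs"
    using ex_has_greatest_nat[of P "[v]" length "Suc (card V)"] by (metis le_imp_less_Suc)
  obtain x ys where x: "xs = x # ys" using xs(1) by (cases xs) (auto simp: P_def)
  have xV: "x \<in> V" using xs(1) x by (simp add: P_def)
  have "2 \<le> card (V - {x})" using V(2) xV fin by simp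
  then obtain y z where yz: "y \<noteq> z" "{x, y} \<in> E" "{x, z} \<in> E" "y \<noteq> x" "z \<noteq> x"
    using well_linked_two_exits[OF wl fin sub, of "{x}"] xV by (metis DiffD2 empty_not_insert
        empty_subsetI insert_subset singletonD singletonI)
  have in_ys: "w \<in> set ys" if "{x, w} \<in> E" "w \<noteq> x" for w
  proof (rule ccontr)
    assume n: "w \<notin> set ys"
    have "w \<in> V" using sub[OF that(1)] by blast
    hence "P (w # xs)" using n that xs(1) x by (auto simp: P_def insert_commute)
    thus False using xs(2) by fastforce
  qed
  obtain w where w: "{x, w} \<in> E" "w \<noteq> x" "w \<in> set ys" "w \<noteq> hd ys"
    using yz in_ys by metis
  then obtain us vs where ys: "ys = us @ w # vs" by (meson split_list)
  have us: "us \<noteq> []" using ys w(4) by auto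
  have "path_edges (x # us @ [w]) \<subseteq> E"
    using xs(1) x ys path_edges_append[of "x # us" w vs] by (auto simp: P_def)
  moreover have "path_edges [w, x] \<subseteq> E" using w(1) by (simp add: insert_commute)
  moreover have "path_edges (x # (us @ [w]) @ [x]) = path_edges (x # us @ [w]) \<union> path_edges [w, x]"
    using path_edges_append[of "x # us" w "[x]"] by simp
  moreover have "distinct (x # us @ [w])" using xs(1) x ys by (auto simp: P_def)
  moreover have "2 \<le> length (us @ [w])" using us by (cases us) auto
  ultimately have "cycle_edges E (path_edges (x # (us @ [w]) @ [x]))"
    unfolding cycle_edges_def by (intro exI[of _ x] exI[of _ "us @ [w]"]) auto
  thus thesis by (rule that)
qed

section \<open>Ears and the edge count inside a cycle\<close>

context plane_graph
begin

text \<open>Without inner vertices an inner edge is a chord. Otherwise the component K of an inner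
  vertex in the graph minus F stays inside, and \<open>well_linked\<close> provides exits from K to
  two different vertices of F; without it the inside could hang on F at a single vertex.\<close>

lemma ear_exists:
  assumes wl: "well_linked V E" and F: "cycle_edges E F"
    and inner: "inner_edges F \<noteq> {} \<or> inner_vertices F \<noteq> {}"
  obtains a b cs where "a \<in> \<Union>F" "b \<in> \<Union>F" "a \<noteq> b"
    "distinct (a # cs @ [b])" "set cs \<inter> \<Union>F = {}" "path_edges (a # cs @ [b]) \<subseteq> E"
    "path_edges (a # cs @ [b]) \<inter> F = {}" "drawn (path_edges (a # cs @ [b])) \<inter> inside (drawn F) \<noteq> {}"
proof (cases "inner_vertices F = {}")
  case True
  have FE: "F \<subseteq> E" using cycle_edges_subset[OF F] .
  obtain e where e: "e \<in> inner_edges F" using inner True by blast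
  hence eE: "e \<in> E" "open_edge e \<subseteq> inside (drawn F)" by (auto simp: inner_edges_def)
  obtain a b where ab: "e = {a, b}" "a \<noteq> b" using edge_card[OF eE(1)] by (auto simp: card_2_iff)
  have "a \<in> \<Union>F" "b \<in> \<Union>F" using inner_edge_end[OF FE e] True ab(1) by blast+
  moreover have "e \<notin> F" using inner_edges_disjoint[OF FE] e by blast
  moreover have "drawn {e} \<inter> inside (drawn F) \<noteq> {}"
    using open_edge_nonempty[OF eE(1)] eE(2) by (auto simp: drawn_def open_edge_def)
  ultimately show thesis using that[of a b "[]"] ab eE(1) by simp
next
  case False
  have FE: "F \<subseteq> E" using cycle_edges_subset[OF F] .
  have FV: "\<Union>F \<subseteq> V" using FE edge_subset by blast
  define S where "S = V - \<Union>F"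
  define R where "R = {(x, y). x \<in> S \<and> y \<in> S \<and> {x, y} \<in> E}"
  obtain u where u: "u \<in> inner_vertices F" using False by blast
  have uS: "u \<in> S" using u inner_vertices_disjoint[OF FE] by (auto simp: S_def inner_vertices_def)
  define K where "K = {v. (u, v) \<in> R\<^sup>*}"
  have K: "v \<in> S \<and> v \<in> inner_vertices F" if "v \<in> K" for v
  proof -
    have "(u, v) \<in> R\<^sup>*" using that by (simp add: K_def)
    thus ?thesis
    proof (induction rule: rtrancl_induct)
      case base
      show ?case using u uS by simp
    next
      case (step y z)
      hence "{y, z} \<in> E" "z \<in> S" by (auto simp: R_def)
      thus ?case using neighbor_inner[OF FE, of y z] step.IH by (auto simp: S_def)
    qed
  qed
  have "K \<noteq> {}" "K \<subseteq> V" using K by (auto simp: K_def S_def)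
  moreover have "2 \<le> card (V - K)"
  proof -
    have "\<Union>F \<subseteq> V - K" using FV K by (auto simp: S_def)
    hence "card (\<Union>F) \<le> card (V - K)" using finV by (intro card_mono) auto
    thus ?thesis using card_cycle_vertices[OF F] by linarith
  qed
  ultimately obtain x y a b where xy: "x \<in> K" "y \<in> K" "a \<in> V - K" "b \<in> V - K" "a \<noteq> b"
    "{x, a} \<in> E" "{y, b} \<in> E"
    using well_linked_two_exits[OF wl finV edge_subset] by metis
  have exit: "w \<in> \<Union>F" if w: "z \<in> K" "w \<in> V - K" "{z, w} \<in> E" for z w
  proof (rule ccontr)
    assume "w \<notin> \<Union>F"
    hence "(z, w) \<in> R" using w K[OF w(1)] by (auto simp: R_def S_def)
    hence "w \<in> K" using w(1) unfolding K_def by (simp add: rtrancl_into_rtrancl)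
    thus False using w(2) by simp
  qed
  have ab: "a \<in> \<Union>F" "b \<in> \<Union>F" using exit xy by blast+
  \<comment> \<open>Both x and y are reached from u, so reversing one connection leads from x to y
    without touching F.\<close>
  have "sym R" by (auto simp: R_def sym_def insert_commute)
  hence "(x, u) \<in> R\<^sup>*" using xy(1) by (auto simp: K_def dest: sym_rtrancl symD)
  hence "(x, y) \<in> R\<^sup>*" using xy(2) by (auto simp: K_def)
  then obtain cs where cs: "distinct cs" "cs \<noteq> []" "hd cs = x" "last cs = y" "set cs \<subseteq> S"
    "path_edges cs \<subseteq> E"
    using rtrancl_imp_distinct_path[of x y S E] K[OF xy(1)] unfolding R_def by metis
  obtain cs1 where cs1: "cs = x # cs1" using cs(2,3) by (cases cs) auto
  obtain cs2 where cs2: "cs = cs2 @ [y]" using cs(2,4) by (metis append_butlast_last_id)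
  have edges: "path_edges (a # cs @ [b]) = insert {a, x} (insert {y, b} (path_edges cs))"
  proof -
    have "path_edges (cs @ [b]) = insert {y, b} (path_edges cs)"
      using path_edges_append[of cs2 y "[b]"] cs2 by simp
    moreover have "path_edges (a # cs @ [b]) = insert {a, x} (path_edges (cs @ [b]))"
      using cs1 by simp
    ultimately show ?thesis by simp
  qed
  have notF: "set cs \<inter> \<Union>F = {}" using cs(5) by (auto simp: S_def)
  show thesis
  proof (rule that[OF ab xy(5), of cs])
    show "distinct (a # cs @ [b])" using cs(1) notF ab xy(5) by auto
    show "set cs \<inter> \<Union>F = {}" by (rule notF)
    show "path_edges (a # cs @ [b]) \<subseteq> E" using edges cs(6) xy(6,7) by (simp add: insert_commute)
    show "path_edges (a # cs @ [b]) \<inter> F = {}"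
    proof -
      have "x \<in> set cs" "y \<in> set cs" using cs(2-4) hd_in_set last_in_set by metis+
      hence "x \<notin> \<Union>F" "y \<notin> \<Union>F" using notF by blast+
      moreover have "e \<notin> F" if e: "e \<in> path_edges cs" for e
      proof
        assume "e \<in> F"
        hence "e \<subseteq> {}" using path_edges_subset[OF e] notF by blast
        thus False using path_edges_card_2[OF cs(1) e] by simp
      qed
      ultimately show ?thesis unfolding edges by blast
    qed
    have "p x \<in> inside (drawn F)" using K[OF xy(1)] by (simp add: inner_vertices_def)
    moreover have "p x \<in> drawn (path_edges (a # cs @ [b]))"
    proof -
      have "{a, x} \<in> E" using xy(6) by (simp add: insert_commute)
      hence "p x \<in> path_image (\<gamma> {a, x})" using edge_ends_drawn by blast
      thus ?thesis unfolding edges drawn_def by blast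
    qed
    ultimately show "drawn (path_edges (a # cs @ [b])) \<inter> inside (drawn F) \<noteq> {}" by blast
  qed
qed

text \<open>By Euler's formula the inside of F would have \<open>m - n + 1\<close> faces, where m and n count the edges and
  vertices inside. Each face has length at least 12, and an edge of F bounds only one of them.\<close>

lemma inner_bound:
  assumes wl: "well_linked V E" and girth: "\<And>F. cycle_edges E F \<Longrightarrow> 12 \<le> card F"
    and F: "cycle_edges E F"
  shows "10 * card (inner_edges F) + 12 \<le> 12 * card (inner_vertices F) + card F"
  using F
proof (induction "card (inner_edges F)" arbitrary: F rule: less_induct)
  case less
  show ?case
  proof (cases "inner_edges F = {}")
    case True
    thus ?thesis using girth[OF less.prems] by simp
  next
    case False
    then obtain a b cs where ear: "a \<in> \<Union>F" "b \<in> \<Union>F" "a \<noteq> b"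
      "distinct (a # cs @ [b])" "set cs \<inter> \<Union>F = {}" "path_edges (a # cs @ [b]) \<subseteq> E"
      "path_edges (a # cs @ [b]) \<inter> F = {}" "drawn (path_edges (a # cs @ [b])) \<inter> inside (drawn F) \<noteq> {}"
      using ear_exists[OF wl less.prems] by metis
    obtain C1 C2 where C: "cycle_edges E C1" "cycle_edges E C2"
      "card C1 + card C2 = card F + 2 * Suc (length cs)"
      "card (inner_edges C1) < card (inner_edges F)" "card (inner_edges C2) < card (inner_edges F)"
      "card (inner_edges F) \<le> card (inner_edges C1) + card (inner_edges C2) + Suc (length cs)"
      "card (inner_vertices C1) + card (inner_vertices C2) + length cs \<le> card (inner_vertices F)"
      using ear_split[OF less.prems ear] by metis
    \<comment> \<open>Let the ear have l inner vertices. Its l + 1 edges count 10 each as inner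
      edges and 2 each in the cycle lengths, 12 l + 12 in total: 12 l is paid by its vertices, and
      12 by one of the two constants in the added bounds.\<close>
    have "card C1 + card C2 = card F + 2 * length cs + 2" using C(3) by simp
    thus ?thesis using less.hyps[OF C(4,1)] less.hyps[OF C(5,2)] C(6,7) by linarith
  qed
qed

text \<open>A cycle with the fewest inner edges has nothing inside, as an ear would split off a
  cycle with fewer.\<close>

lemma facial_cycle_exists:
  assumes wl: "well_linked V E" and "cycle_edges E F0"
  obtains F where "cycle_edges E F" "inner_edges F = {}" "inner_vertices F = {}"
proof -
  obtain F where F: "cycle_edges E F" "\<And>F'. cycle_edges E F' \<Longrightarrow> card (inner_edges F) \<le> card (inner_edges F')"
    using ex_has_least_nat[of "cycle_edges E" F0 "\<lambda>F. card (inner_edges F)"] assms(2) by metis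
  have "\<not> (inner_edges F \<noteq> {} \<or> inner_vertices F \<noteq> {})"
  proof
    assume "inner_edges F \<noteq> {} \<or> inner_vertices F \<noteq> {}"
    then obtain a b cs where ear: "a \<in> \<Union>F" "b \<in> \<Union>F" "a \<noteq> b"
      "distinct (a # cs @ [b])" "set cs \<inter> \<Union>F = {}" "path_edges (a # cs @ [b]) \<subseteq> E"
      "path_edges (a # cs @ [b]) \<inter> F = {}" "drawn (path_edges (a # cs @ [b])) \<inter> inside (drawn F) \<noteq> {}"
      using ear_exists[OF wl F(1)] by metis
    obtain C where "cycle_edges E C" "card (inner_edges C) < card (inner_edges F)"
      using ear_split[OF F(1) ear] by metis
    thus False using F(2) by fastforce
  qed
  thus thesis using that F(1) by blast
qed

end

text \<open>Each side is mapped, away from z0, to one side of the image curve. Points near z0 go to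
  infinity, so the punctured inside goes outside. If the outside did so too, only 0, the image of
  infinity, could be left inside the new curve, whose inside is open and nonempty.\<close>

lemma inversion_swaps_sides:
  fixes c :: "real \<Rightarrow> complex"
  assumes c: "simple_path c" "pathfinish c = pathstart c" and z0: "z0 \<in> inside (path_image c)"
  defines "f \<equiv> \<lambda>z. inverse (z - z0)"
  shows "f ` outside (path_image c) \<subseteq> inside (f ` path_image c)"
proof -
  let ?S = "path_image c" and ?S' = "f ` path_image c"
  note J = Jordan_inside_outside[OF c]
  have inj: "inj_on f (- {z0})" by (auto simp: f_def inj_on_def)
  have cont: "continuous_on (- {z0}) f" unfolding f_def by (intro continuous_intros) auto
  have S: "?S \<subseteq> - {z0}" using z0 inside_no_overlap[of ?S] by blast
  have c': "simple_path (f \<circ> c)" "pathfinish (f \<circ> c) = pathstart (f \<circ> c)" "path_image (f \<circ> c) = ?S'"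
    using simple_path_continuous_image[OF c(1) continuous_on_subset[OF cont S] inj_on_subset[OF inj S]]
      c(2) by (simp_all add: path_image_compose pathfinish_compose pathstart_compose)
  note J' = Jordan_inside_outside[OF c'(1,2), unfolded c'(3)]
  have closed: "closed ?S'"
    using closed_simple_path_image[OF c'(1)] c'(3) by simp
  have disj: "f ` A \<inter> ?S' = {}" if "A \<subseteq> - {z0}" "A \<inter> ?S = {}" for A
    using inj_on_image_Int[OF inj that(1) S] that(2) by simp
  have out: "outside ?S \<subseteq> - {z0}" using z0 inside_Int_outside[of ?S] by blast
  have outS: "f ` outside ?S \<inter> ?S' = {}"
    using disj[OF out] outside_no_overlap[of ?S] by (simp add: Int_commute)
  have inS: "f ` (inside ?S - {z0}) \<inter> ?S' = {}"
    using disj[of "inside ?S - {z0}"] inside_no_overlap[of ?S] by blast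
  have "connected (f ` outside ?S)"
    using J continuous_on_subset[OF cont out] by (blast intro: connected_continuous_image)
  hence side: "f ` outside ?S \<subseteq> inside ?S' \<or> f ` outside ?S \<subseteq> outside ?S'"
    using connected_inside_or_outside[OF closed _ outS] by blast
  obtain r where r: "0 < r" "ball z0 r \<subseteq> inside ?S"
    using J z0 by (meson open_contains_ball)
  have "connected (inside ?S - {z0})"
    using J by (intro connected_open_delete) auto
  moreover have "continuous_on (inside ?S - {z0}) f"
    by (rule continuous_on_subset[OF cont]) auto
  ultimately have "connected (f ` (inside ?S - {z0}))" by (rule connected_continuous_image[rotated])
  hence "f ` (inside ?S - {z0}) \<subseteq> inside ?S' \<or> f ` (inside ?S - {z0}) \<subseteq> outside ?S'"
    using connected_inside_or_outside[OF closed _ inS] by blast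
  moreover have "\<not> f ` (inside ?S - {z0}) \<subseteq> inside ?S'"
  proof
    assume sub: "f ` (inside ?S - {z0}) \<subseteq> inside ?S'"
    have "bounded (inside ?S')" using J' by simp
    then obtain B where B0: "0 < B" "\<forall>w \<in> inside ?S'. norm w \<le> B"
      unfolding bounded_pos by blast
    have B: "norm (f z) \<le> B" if "z \<in> inside ?S - {z0}" for z
      using sub B0(2) that by blast
    \<comment> \<open>Less than r to remain in the ball, and so small that 1 / t, the norm of the
      image, is at least 2 B.\<close>
    define t where "t = min (r / 2) (1 / (2 * B))"
    have t: "0 < t" "t < r" "t \<le> 1 / (2 * B)" using r(1) B0(1) by (auto simp: t_def)
    have "z0 + of_real t \<in> inside ?S - {z0}"
      using r(2) t by (auto simp: dist_norm subset_iff)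
    hence "norm (f (z0 + of_real t)) \<le> B" by (rule B)
    moreover have "norm (f (z0 + of_real t)) = 1 / t"
      using t(1) unfolding f_def by (simp add: norm_inverse inverse_eq_divide norm_divide)
    ultimately have "1 / t \<le> B" by simp
    hence "1 \<le> B * t" using t(1) by (simp add: field_simps)
    moreover have "B * t \<le> 1 / 2" using t(3) B0(1) by (simp add: field_simps)
    ultimately show False by simp
  qed
  ultimately have ins: "f ` (inside ?S - {z0}) \<subseteq> outside ?S'" by blast
  have "\<not> f ` outside ?S \<subseteq> outside ?S'"
  proof
    assume o: "f ` outside ?S \<subseteq> outside ?S'"
    have "inside ?S' \<subseteq> {0}"
    proof
      fix w assume w: "w \<in> inside ?S'"
      show "w \<in> {0}"
      proof (rule ccontr)
        assume "w \<notin> {0}"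
        define z where "z = z0 + inverse w"
        have z: "f z = w" "z \<noteq> z0" using \<open>w \<notin> {0}\<close> by (auto simp: f_def z_def)
        have "z \<notin> ?S" using w z(1) inside_no_overlap[of ?S'] by blast
        hence "z \<in> inside ?S - {z0} \<or> z \<in> outside ?S" using z(2) inside_Un_outside[of ?S] by blast
        hence "w \<in> outside ?S'" using z(1) ins o by blast
        thus False using w inside_Int_outside[of ?S'] by blast
      qed
    qed
    hence "inside ?S' = {0}" using J' by blast
    thus False using J' not_open_singleton by metis
  qed
  thus ?thesis using side by blast
qed

lemma plane_drawing_image:
  assumes "plane_drawing V E p \<gamma>" "\<And>e. e \<in> E \<Longrightarrow> e \<subseteq> V"
    and f: "continuous_on A f" "inj_on f A" and A: "p ` V \<subseteq> A" "\<And>e. e \<in> E \<Longrightarrow> path_image (\<gamma> e) \<subseteq> A"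
  shows "plane_drawing V E (f \<circ> p) (\<lambda>e. f \<circ> \<gamma> e)"
proof -
  have d: "inj_on p V" "\<And>e. e \<in> E \<Longrightarrow> arc (\<gamma> e)"
    "\<And>e. e \<in> E \<Longrightarrow> {pathstart (\<gamma> e), pathfinish (\<gamma> e)} = p ` e"
    "\<And>e. e \<in> E \<Longrightarrow> path_image (\<gamma> e) \<inter> p ` V = p ` e"
    "\<And>e e'. e \<in> E \<Longrightarrow> e' \<in> E \<Longrightarrow> e \<noteq> e' \<Longrightarrow> path_image (\<gamma> e) \<inter> path_image (\<gamma> e') \<subseteq> p ` (e \<inter> e')"
    using assms(1) by (auto simp: plane_drawing_def)
  show ?thesis
    unfolding plane_drawing_def
  proof (intro conjI ballI impI)
    show "inj_on (f \<circ> p) V" using d(1) inj_on_subset[OF f(2) A(1)] by (rule comp_inj_on)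
  next
    fix e assume e: "e \<in> E"
    show "arc (f \<circ> \<gamma> e)"
      using d(2)[OF e] continuous_on_subset[OF f(1) A(2)[OF e]] inj_on_subset[OF f(2) A(2)[OF e]]
      by (auto simp: arc_def path_image_def intro: path_continuous_image comp_inj_on)
    have "f ` {pathstart (\<gamma> e), pathfinish (\<gamma> e)} = f ` p ` e" using d(3)[OF e] by simp
    thus "{pathstart (f \<circ> \<gamma> e), pathfinish (f \<circ> \<gamma> e)} = (f \<circ> p) ` e"
      by (simp add: pathstart_compose pathfinish_compose image_comp)
    have "f ` path_image (\<gamma> e) \<inter> f ` p ` V = f ` p ` e"
      using inj_on_image_Int[OF f(2) A(2)[OF e] A(1)] d(4)[OF e] by simp
    thus "path_image (f \<circ> \<gamma> e) \<inter> (f \<circ> p) ` V = (f \<circ> p) ` e"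
      by (simp add: path_image_compose image_comp)
  next
    fix e e' assume e: "e \<in> E" "e' \<in> E" "e \<noteq> e'"
    have "f ` path_image (\<gamma> e) \<inter> f ` path_image (\<gamma> e') = f ` (path_image (\<gamma> e) \<inter> path_image (\<gamma> e'))"
      using inj_on_image_Int[OF f(2) A(2)[OF e(1)] A(2)[OF e(2)]] by simp
    also have "\<dots> \<subseteq> f ` p ` (e \<inter> e')" using d(5)[OF e] by blast
    finally show "path_image (f \<circ> \<gamma> e) \<inter> path_image (f \<circ> \<gamma> e') \<subseteq> (f \<circ> p) ` (e \<inter> e')"
      by (simp add: path_image_compose image_comp)
  qed
qed

lemma (in plane_graph) well_linked_edge_bound:
  assumes wl: "well_linked V E" and girth: "\<And>F. cycle_edges E F \<Longrightarrow> 12 \<le> card F"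
    and V: "3 \<le> card V"
  shows "5 * card E + 6 \<le> 6 * card V"
proof -
  obtain F0 where "cycle_edges E F0" using well_linked_cycle[OF wl simple V] by blast
  then obtain F where F: "cycle_edges E F" "inner_edges F = {}" "inner_vertices F = {}"
    using facial_cycle_exists[OF wl] by blast
  have FE: "F \<subseteq> E" using cycle_edges_subset[OF F(1)] .
  have FV: "\<Union>F \<subseteq> V" using FE edge_subset by blast
  obtain c where c: "simple_path c" "pathfinish c = pathstart c" "path_image c = drawn F"
    using cycle_loop[OF F(1)] by blast
  obtain z0 where z0: "z0 \<in> inside (drawn F)" using Jordan_inside_outside[OF c(1,2)] c(3) by auto
  define f where "f = (\<lambda>z. inverse (z - z0))"
  have outer_edge: "open_edge e \<subseteq> outside (drawn F)" if "e \<in> E - F" for e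
    using edge_inner_or_outer[OF FE, of e] that F(2) by blast
  have outer_vertex: "p v \<in> outside (drawn F)" if "v \<in> V - \<Union>F" for v
  proof -
    have "p v \<notin> drawn F" using vertex_drawn_iff[OF _ FE, of v] that by blast
    moreover have "p v \<notin> inside (drawn F)" using F(3) that by (auto simp: inner_vertices_def)
    ultimately show ?thesis using inside_Un_outside[of "drawn F"] by blast
  qed
  \<comment> \<open>There is no vertex or edge inside F, so z0 is off the drawing and the inversion
    is continuous and injective along it.\<close>
  have z0_p: "p v \<noteq> z0" if "v \<in> V" for v
    using z0 F(3) that by (auto simp: inner_vertices_def)
  have z0_edge: "z0 \<notin> path_image (\<gamma> e)" if e: "e \<in> E" for e
  proof
    assume z: "z0 \<in> path_image (\<gamma> e)"
    have "z0 \<notin> drawn F" using z0 inside_no_overlap[of "drawn F"] by blast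
    hence "e \<notin> F" using z by (auto simp: drawn_def)
    moreover have "z0 \<notin> p ` e" using z0_p edge_subset[OF e] by blast
    hence "z0 \<in> open_edge e" using z by (simp add: open_edge_def)
    ultimately show False using outer_edge[of e] e z0 inside_Int_outside[of "drawn F"] by blast
  qed
  have inj: "inj_on f (- {z0})" by (auto simp: f_def inj_on_def)
  have "plane_drawing V E (f \<circ> p) (\<lambda>e. f \<circ> \<gamma> e)"
  proof (rule plane_drawing_image[OF drawing edge_subset _ inj])
    show "continuous_on (- {z0}) f" unfolding f_def by (intro continuous_intros) auto
  qed (use z0_p z0_edge in blast)+
  then interpret inv: plane_graph V E "f \<circ> p" "\<lambda>e. f \<circ> \<gamma> e"
    using simple by unfold_locales
  have drawn': "inv.drawn F = f ` drawn F"
    unfolding inv.drawn_def drawn_def by (auto simp: path_image_compose)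
  have swap: "f ` outside (drawn F) \<subseteq> inside (inv.drawn F)"
    using inversion_swaps_sides[OF c(1,2), unfolded c(3), OF z0, folded f_def] unfolding drawn' .
  have "E - F \<subseteq> inv.inner_edges F"
  proof
    fix e assume e: "e \<in> E - F"
    have "p ` e \<subseteq> - {z0}" "path_image (\<gamma> e) \<subseteq> - {z0}"
      using z0_p z0_edge edge_subset[of e] e by blast+
    hence "f ` (path_image (\<gamma> e) - p ` e) = f ` path_image (\<gamma> e) - f ` p ` e"
      by (intro inj_on_image_set_diff[OF inj]) auto
    hence "inv.open_edge e = f ` open_edge e"
      unfolding inv.open_edge_def open_edge_def path_image_compose image_comp by simp
    thus "e \<in> inv.inner_edges F"
      using outer_edge[OF e] swap e unfolding inv.inner_edges_def by blast
  qed
  moreover have "V - \<Union>F = inv.inner_vertices F"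
  proof
    show "V - \<Union>F \<subseteq> inv.inner_vertices F"
      using outer_vertex swap unfolding inv.inner_vertices_def by auto
    show "inv.inner_vertices F \<subseteq> V - \<Union>F"
      using inv.inner_vertices_disjoint[OF FE] by (auto simp: inv.inner_vertices_def)
  qed
  ultimately have "10 * card (E - F) + 12 \<le> 12 * card (V - \<Union>F) + card F"
    using inv.inner_bound[OF wl girth F(1)] card_mono[OF inv.finite_inner(1), of "E - F" F] by simp
  moreover have "card (E - F) = card E - card F" "card F \<le> card E"
    using FE finE finite_subset[OF FE finE] by (simp_all add: card_Diff_subset card_mono)
  moreover have "card (V - \<Union>F) = card V - card F" "card F \<le> card V"
    using FV finV card_cycle_vertices[OF F(1)] card_mono[OF finV FV] by (simp_all add: card_Diff_subset)
  \<comment> \<open>With c = card F this is 10 (card E - c) + 12 <= 12 (card V - c) + c, hence 10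
    card E + 12 <= 12 card V - c.\<close>
  ultimately show ?thesis by linarith
qed

section \<open>Subgraphs and gluing along a cut vertex\<close>

lemma plane_drawing_subgraph:
  assumes "plane_drawing V E p \<gamma>" "W \<subseteq> V" "F \<subseteq> E" "\<And>e. e \<in> F \<Longrightarrow> e \<subseteq> W"
  shows "plane_drawing W F p \<gamma>"
proof -
  have d: "inj_on p V" "\<And>e. e \<in> E \<Longrightarrow> arc (\<gamma> e)"
    "\<And>e. e \<in> E \<Longrightarrow> {pathstart (\<gamma> e), pathfinish (\<gamma> e)} = p ` e"
    "\<And>e. e \<in> E \<Longrightarrow> path_image (\<gamma> e) \<inter> p ` V = p ` e"
    "\<And>e e'. e \<in> E \<Longrightarrow> e' \<in> E \<Longrightarrow> e \<noteq> e' \<Longrightarrow> path_image (\<gamma> e) \<inter> path_image (\<gamma> e') \<subseteq> p ` (e \<inter> e')"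
    using assms(1) by (auto simp: plane_drawing_def)
  show ?thesis
    unfolding plane_drawing_def
  proof (intro conjI ballI impI)
    show "inj_on p W" by (rule inj_on_subset[OF d(1) assms(2)])
  next
    fix e assume e: "e \<in> F"
    hence eE: "e \<in> E" using assms(3) by blast
    show "arc (\<gamma> e)" by (rule d(2)[OF eE])
    show "{pathstart (\<gamma> e), pathfinish (\<gamma> e)} = p ` e" by (rule d(3)[OF eE])
    show "path_image (\<gamma> e) \<inter> p ` W = p ` e"
    proof -
      have "A \<inter> B' = C" if "A \<inter> B = C" "B' \<subseteq> B" "C \<subseteq> B'" for A B B' C :: "complex set"
        using that by blast
      thus ?thesis using d(4)[OF eE] image_mono[OF assms(2)] image_mono[OF assms(4)[OF e]] by metis
    qed
  next
    fix e e' assume "e \<in> F" "e' \<in> F" "e \<noteq> e'"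
    thus "path_image (\<gamma> e) \<inter> path_image (\<gamma> e') \<subseteq> p ` (e \<inter> e')" using d(5)[of e e'] assms(3) by blast
  qed
qed

lemma cycle_edges_mono: "cycle_edges E F \<Longrightarrow> E \<subseteq> E' \<Longrightarrow> cycle_edges E' F"
  unfolding cycle_edges_def by blast

text \<open>The summand 6 is the weight of one vertex and lets the bound survive gluing: if
  \<open>well_linked\<close> fails, the parts on \<open>K\<close> with \<open>T\<close> and on
  \<open>V - K\<close> share at most one vertex, and its double count is paid by the second
  6.\<close>

theorem plane_graph_edge_bound:
  assumes "simple_graph V E" "plane_drawing V E p \<gamma>" "V \<noteq> {}"
    and "\<And>F. cycle_edges E F \<Longrightarrow> 12 \<le> card F"
  shows "5 * card E + 6 \<le> 6 * card V"
  using assms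
proof (induction "card V" arbitrary: V E rule: less_induct)
  case less
  have fin: "finite V" and sub: "\<And>e. e \<in> E \<Longrightarrow> e \<subseteq> V" and c2: "\<And>e. e \<in> E \<Longrightarrow> card e = 2"
    using less.prems(1) by (auto simp: simple_graph_def)
  have finE: "finite E" using fin sub by (intro finite_subset[of E "Pow V"]) auto
  interpret plane_graph V E p \<gamma> by unfold_locales (use less.prems in auto)
  have IH: "5 * card F + 6 \<le> 6 * card W"
    if "W \<subset> V" "W \<noteq> {}" "F \<subseteq> E" "\<And>e. e \<in> F \<Longrightarrow> e \<subseteq> W" for W F
  proof (rule less.hyps)
    show "card W < card V" using that(1) fin by (rule psubset_card_mono[rotated])
    show "simple_graph W F"
      using that fin c2 finite_subset[of W V] unfolding simple_graph_def by blast
    show "plane_drawing W F p \<gamma>" using plane_drawing_subgraph[OF less.prems(2)] that by blast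
    show "12 \<le> card F'" if "cycle_edges F F'" for F'
      using less.prems(4) cycle_edges_mono[OF that] \<open>F \<subseteq> E\<close> by blast
  qed fact
  show ?case
  proof (cases "card V \<le> 2")
    case True
    have cV: "0 < card V" using less.prems(3) fin by (simp add: card_gt_0_iff)
    have "E \<subseteq> {V}"
    proof
      fix e assume e: "e \<in> E"
      have "e = V" using card_seteq[OF fin sub[OF e]] c2[OF e] True by simp
      thus "e \<in> {V}" by simp
    qed
    show ?thesis
    proof (cases "E = {}")
      case True
      thus ?thesis using cV by simp
    next
      case False
      hence "E = {V}" using \<open>E \<subseteq> {V}\<close> by blast
      thus ?thesis using c2[of V] by simp
    qed
  next
    case False
    show ?thesis
    proof (cases "well_linked V E")
      case True
      show ?thesis
        by (rule well_linked_edge_bound[OF True less.prems(4)]) (use False in auto)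
    next
      case nwl: False
      obtain K T where KT: "K \<noteq> {}" "K \<subseteq> V" "T \<subseteq> V" "K \<inter> T = {}" "card T \<le> 1"
        "\<And>x y. x \<in> K \<Longrightarrow> {x, y} \<in> E \<Longrightarrow> y \<in> K \<union> T" "K \<union> T \<noteq> V"
        using nwl unfolding well_linked_def by blast
      define E1 where "E1 = {e \<in> E. e \<inter> K \<noteq> {}}"
      define E2 where "E2 = {e \<in> E. e \<inter> K = {}}"
      have "e \<subseteq> K \<union> T" if e: "e \<in> E1" for e
      proof -
        obtain x where x: "x \<in> e" "x \<in> K" using e by (auto simp: E1_def)
        obtain y where "e = {x, y}" using c2[of e] e x(1) by (auto simp: E1_def card_2_iff)
        thus ?thesis using KT(6)[of x y] x e by (auto simp: E1_def)
      qed
      hence 1: "5 * card E1 + 6 \<le> 6 * card (K \<union> T)"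
        using IH[of "K \<union> T" E1] KT by (auto simp: E1_def)
      have 2: "5 * card E2 + 6 \<le> 6 * card (V - K)"
      proof (rule IH)
        show "V - K \<subset> V" "V - K \<noteq> {}" using KT(1-3,7) by blast+
        show "E2 \<subseteq> E" by (auto simp: E2_def)
        show "e \<subseteq> V - K" if "e \<in> E2" for e using that sub[of e] by (auto simp: E2_def)
      qed
      have "card E = card E1 + card E2"
      proof -
        have "E = E1 \<union> E2" "E1 \<inter> E2 = {}" by (auto simp: E1_def E2_def)
        thus ?thesis using finE card_Un_disjoint[of E1 E2] by simp
      qed
      moreover have "card (K \<union> T) = card K + card T"
        using KT fin finite_subset by (intro card_Un_disjoint) blast+
      moreover have "card (V - K) = card V - card K" "card K \<le> card V"
        using KT fin finite_subset[OF KT(2) fin] by (simp_all add: card_Diff_subset card_mono)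
      ultimately show ?thesis using 1 2 KT(5) by linarith
    qed
  qed
qed

section \<open>The 2-tone chromatic number\<close>

lemma two_times_choose_two: "2 * real (n choose 2) = real n * (real n - 1)"
proof -
  have "2 * (n choose 2) = n * (n - 1)"
    unfolding choose_two by (cases n) simp_all
  hence "2 * real (n choose 2) = real n * real (n - 1)"
    by (metis of_nat_mult of_nat_numeral)
  thus ?thesis by (cases n) simp_all
qed

text \<open>Completing the square produces the constants of the bound.\<close>

lemma choose_two_minus_two:
  assumes "2 \<le> k"
  shows "2 * real ((k - 2) choose 2) = (real k - 2.5)\<^sup>2 - 0.25"
  using two_times_choose_two[of "k - 2"] assms
  by (simp add: of_nat_diff power2_eq_square algebra_simps)

text \<open>Turns the real bound into the binomial condition that governs both directions. From
  \<open>k = 3\<close> on, \<open>k - 2.5\<close> is nonnegative and squaring is reversible.\<close>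

lemma bound_le_iff:
  assumes "3 \<le> k"
  shows "\<lceil>sqrt (2 * real D + 0.25) + 2.5\<rceil> \<le> int k \<longleftrightarrow> D \<le> (k - 2) choose 2"
proof -
  have k: "0 \<le> real k - 2.5" using assms by simp
  have "\<lceil>sqrt (2 * real D + 0.25) + 2.5\<rceil> \<le> int k \<longleftrightarrow> sqrt (2 * real D + 0.25) \<le> real k - 2.5"
    by (auto simp: ceiling_le_iff)
  also have "\<dots> \<longleftrightarrow> 2 * real D + 0.25 \<le> (real k - 2.5)\<^sup>2"
    using k by (metis real_le_lsqrt real_sqrt_le_iff real_sqrt_unique sqrt_le_D)
  also have "(real k - 2.5)\<^sup>2 = 2 * real ((k - 2) choose 2) + 0.25"
    using choose_two_minus_two[of k] assms by simp
  finally show ?thesis by simp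
qed

section \<open>Degrees and density in terms of adjacency\<close>

abbreviation adjacent where "adjacent E u v \<equiv> {u, v} \<in> E"

lemma degree_eq_card_nbh:
  assumes "simple_graph V E"
  shows "degree E v = card (nbh (adjacent E) V v)"
proof -
  have "{e \<in> E. v \<in> e} = (\<lambda>w. {v, w}) ` nbh (adjacent E) V v"
  proof (intro equalityI subsetI)
    fix e assume e: "e \<in> {e \<in> E. v \<in> e}"
    hence "card e = 2" "e \<subseteq> V" using assms by (auto simp: simple_graph_def)
    then obtain w where "e = {v, w}" using e by (auto simp: card_2_iff)
    thus "e \<in> (\<lambda>w. {v, w}) ` nbh (adjacent E) V v" using e \<open>e \<subseteq> V\<close> by (auto simp: nbh_def)
  qed (auto simp: nbh_def)
  moreover have "inj_on (\<lambda>w. {v, w}) (nbh (adjacent E) V v)"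
    by (auto simp: inj_on_def doubleton_eq_iff)
  ultimately show ?thesis by (simp add: degree_def card_image)
qed

lemma handshake:
  assumes "simple_graph V E" "W \<subseteq> V"
  shows "(\<Sum>u\<in>W. card (nbh (adjacent E) W u)) = 2 * card {e \<in> E. e \<subseteq> W}"
proof -
  let ?F = "{e \<in> E. e \<subseteq> W}"
  have finW: "finite W" using assms finite_subset by (auto simp: simple_graph_def)
  have F: "simple_graph W ?F" using assms(1) finW by (auto simp: simple_graph_def)
  have "finite ?F" using finW by (intro finite_subset[of ?F "Pow W"]) auto
  moreover have "card {u \<in> W. u \<in> e} = 2" if "e \<in> ?F" for e
  proof -
    have "{u \<in> W. u \<in> e} = e" using that by blast
    thus ?thesis using F that by (simp add: simple_graph_def)
  qed
  ultimately have "(\<Sum>u\<in>W. card {e \<in> ?F. u \<in> e}) = 2 * card ?F"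
    using finW by (intro sum_multicount) auto
  moreover have "card {e \<in> ?F. u \<in> e} = card (nbh (adjacent E) W u)" if "u \<in> W" for u
  proof -
    have "nbh (adjacent ?F) W u = nbh (adjacent E) W u" using that by (auto simp: nbh_def)
    thus ?thesis using degree_eq_card_nbh[OF F, of u] by (simp add: degree_def)
  qed
  ultimately show ?thesis by simp
qed

lemma mad_less_iff:
  assumes "simple_graph V E" "V \<noteq> {}"
  shows "mad V E < c \<longleftrightarrow> (\<forall>W F. W \<subseteq> V \<and> W \<noteq> {} \<and> F \<subseteq> E \<and> simple_graph W F \<longrightarrow>
    2 * real (card F) / real (card W) < c)"
proof -
  let ?M = "{2 * real (card F) / real (card W) | W F.
     W \<subseteq> V \<and> W \<noteq> {} \<and> F \<subseteq> E \<and> simple_graph W F}"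
  have fin: "finite V" "finite E"
    using assms(1) finite_subset[of E "Pow V"] by (auto simp: simple_graph_def)
  have "?M \<subseteq> (\<lambda>(W, F). 2 * real (card F) / real (card W)) ` (Pow V \<times> Pow E)" by auto
  hence "finite ?M" using fin finite_subset by blast
  moreover have "2 * real (card ({} :: 'a set set)) / real (card V) \<in> ?M"
    using assms fin by (intro CollectI exI[of _ V] exI[of _ "{}"]) (auto simp: simple_graph_def)
  ultimately have "Max ?M < c \<longleftrightarrow> (\<forall>x\<in>?M. x < c)" by (intro Max_less_iff) auto
  thus ?thesis unfolding mad_def by blast
qed

lemma low_density_of_mad:
  assumes "simple_graph V E" "V \<noteq> {}" "mad V E < 12 / 5"
  shows "low_density (adjacent E) V"
  unfolding low_density_def
proof (intro allI impI)
  fix W assume W: "W \<subseteq> V" "W \<noteq> {}"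
  let ?F = "{e \<in> E. e \<subseteq> W}"
  have finW: "finite W" using assms(1) W(1) finite_subset by (auto simp: simple_graph_def)
  have "simple_graph W ?F" using assms(1) finW by (auto simp: simple_graph_def)
  hence "W \<subseteq> V \<and> W \<noteq> {} \<and> ?F \<subseteq> E \<and> simple_graph W ?F" using W by simp
  hence "2 * real (card ?F) / real (card W) < 12 / 5"
    by (rule mad_less_iff[OF assms(1,2), THEN iffD1, OF assms(3), rule_format])
  moreover have "0 < card W" using W(2) finW by (simp add: card_gt_0_iff)
  ultimately have "5 * (2 * real (card ?F)) < 12 * real (card W)" by (simp add: field_simps)
  thus "5 * (\<Sum>u\<in>W. card (nbh (adjacent E) W u)) < 12 * card W"
    unfolding handshake[OF assms(1) W(1)] by linarith
qed

section \<open>Tone colorings and partial colorings\<close>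

lemma graph_dist_le:
  assumes "graph_path V E xs" "hd xs = v" "last xs = w"
  shows "graph_dist V E v w \<le> enat (length xs - 1)"
  unfolding graph_dist_def by (rule INF_lower) (use assms in simp)

text \<open>Instead of computing the distance, each path is examined. Two vertices on it force
  disjoint labels and three force distinct ones; from four on, the length exceeds the size of a
  label.\<close>

lemma tone_coloring_of_partial:
  assumes col: "partial_coloring (adjacent E) k V V f"
  shows "tone_coloring 2 k V E f"
  unfolding tone_coloring_def
proof (intro conjI ballI impI)
  fix v assume "v \<in> V"
  hence "f v \<in> labels k" using col by (simp add: partial_coloring_def)
  thus "f v \<subseteq> {1..k}" "card (f v) = 2" by (auto simp: labels_def)
next
  fix v w assume vw: "v \<in> V" "w \<in> V" "v \<noteq> w"
  have lab: "f v \<in> labels k" "f w \<in> labels k" using col vw by (simp_all add: partial_coloring_def)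
  have fin: "finite (f v)" "finite (f w)" "card (f v) = 2" "card (f w) = 2"
    using lab label_finite[OF lab(1)] label_finite[OF lab(2)] by (simp_all add: labels_def)
  have le2: "card (f v \<inter> f w) \<le> 2" using fin card_mono[of "f v" "f v \<inter> f w"] by simp
  \<comment> \<open>The \<open>Suc\<close> turns the strict inequality into one that survives the
    infimum, which is infinite if there is no path.\<close>
  have "Suc (card (f v \<inter> f w)) \<le> length xs - 1"
    if xs: "graph_path V E xs" "hd xs = v" "last xs = w" for xs
  proof -
    consider "xs = []" | x where "xs = [x]" | x y where "xs = [x, y]" | x y z where "xs = [x, y, z]"
      | x y z u us where "xs = x # y # z # u # us"
      by (metis list.exhaust)
    thus ?thesis
    proof cases
      case 1 thus ?thesis using xs(1) by (simp add: graph_path_def)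
    next
      case 2 thus ?thesis using xs(2,3) vw(3) by simp
    next
      case 3
      hence "{v, w} \<in> E" using xs by (simp add: graph_path_def)
      hence "f v \<inter> f w = {}" using col vw by (simp add: partial_coloring_def)
      thus ?thesis using 3 by simp
    next
      case (4 x y z)
      hence "{v, y} \<in> E" "{y, w} \<in> E" "y \<in> V" using xs by (simp_all add: graph_path_def)
      hence ne: "f v \<noteq> f w" using col vw unfolding partial_coloring_def by blast
      have "card (f v \<inter> f w) \<noteq> 2"
      proof
        assume c: "card (f v \<inter> f w) = 2"
        have "f v \<inter> f w = f v" "f v \<inter> f w = f w"
          using card_subset_eq[of "f v" "f v \<inter> f w"] card_subset_eq[of "f w" "f v \<inter> f w"] fin c by auto
        thus False using ne by simp
      qed
      thus ?thesis using le2 4 by simp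
    next
      case 5
      thus ?thesis using le2 by simp
    qed
  qed
  hence "enat (Suc (card (f v \<inter> f w))) \<le> graph_dist V E v w"
    unfolding graph_dist_def by (intro INF_greatest) simp
  thus "enat (card (f v \<inter> f w)) < graph_dist V E v w"
    by (rule order_less_le_trans[rotated]) simp
qed

lemma tone_coloring_degree_le:
  assumes G: "simple_graph V E" and col: "tone_coloring 2 k V E f" and v: "v \<in> V"
  shows "degree E v \<le> (k - 2) choose 2"
proof -
  let ?N = "nbh (adjacent E) V v"
  have lab: "f u \<in> labels k" if "u \<in> V" for u
    using col that by (simp add: tone_coloring_def labels_def)
  have loop: "{u, u} \<notin> E" for u using G by (auto simp: simple_graph_def)
  have N: "w \<in> V" "{v, w} \<in> E" "{w, v} \<in> E" "v \<noteq> w" if "w \<in> ?N" for w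
    using that loop by (auto simp: nbh_def insert_commute)
  have "f w \<inter> f v = {}" if w: "w \<in> ?N" for w
  proof -
    have "graph_dist V E v w \<le> enat (length [v, w] - 1)"
      using N[OF w] v by (intro graph_dist_le) (auto simp: graph_path_def)
    moreover have "enat (card (f v \<inter> f w)) < graph_dist V E v w"
      using col v N[OF w] unfolding tone_coloring_def by blast
    ultimately have "enat (card (f v \<inter> f w)) < enat (length [v, w] - 1)" by (rule order_less_le_trans[rotated])
    hence "card (f v \<inter> f w) = 0" by simp
    thus ?thesis using label_finite[OF lab[OF v]] by auto
  qed
  hence "f ` ?N \<subseteq> {L \<in> labels k. L \<inter> f v = {}}" using lab N(1) by blast
  moreover have "inj_on f ?N"
  proof (rule inj_onI, rule ccontr)
    fix u w assume uw: "u \<in> ?N" "w \<in> ?N" "f u = f w" "u \<noteq> w"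
    have "graph_dist V E u w \<le> enat (length [u, v, w] - 1)"
      using N[OF uw(1)] N[OF uw(2)] uw(4) v by (intro graph_dist_le) (auto simp: graph_path_def)
    moreover have "enat (card (f u \<inter> f w)) < graph_dist V E u w"
      using col N[OF uw(1)] N[OF uw(2)] uw(4) unfolding tone_coloring_def by blast
    ultimately have "enat (card (f u \<inter> f w)) < enat (length [u, v, w] - 1)" by (rule order_less_le_trans[rotated])
    moreover have "card (f w) = 2" using lab[OF N(1)[OF uw(2)]] by (simp add: labels_def)
    ultimately show False using uw(3) by simp
  qed
  ultimately have "card ?N \<le> card {L \<in> labels k. L \<inter> f v = {}}"
    using finite_labels[of k] by (intro card_inj_on_le) auto
  also have "\<dots> = (k - 2) choose 2"
    using card_labels_avoiding[of "f v" k] lab[OF v] by (simp add: labels_def)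
  finally show ?thesis using degree_eq_card_nbh[OF G] by simp
qed

lemma tone_coloring_exists:
  assumes G: "simple_graph V E" "V \<noteq> {}" and mad: "mad V E < 12 / 5"
    and k: "7 \<le> k" "max_degree V E \<le> (k - 2) choose 2"
  obtains f where "tone_coloring 2 k V E f"
proof -
  have finV: "finite V" using G(1) by (simp add: simple_graph_def)
  have "card (nbh (adjacent E) V u) \<le> (k - 2) choose 2" if "u \<in> V" for u
  proof -
    have "degree E u \<le> max_degree V E" unfolding max_degree_def using finV that by simp
    thus ?thesis using k(2) degree_eq_card_nbh[OF G(1), of u] by simp
  qed
  moreover have "\<not> adjacent E u u" for u using G(1) by (auto simp: simple_graph_def)
  ultimately have "bounded_degree_graph (adjacent E) k V"
    using k(1) finV by unfold_locales (auto simp: insert_commute)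
  then obtain f where "partial_coloring (adjacent E) k V V f"
    using low_density_colorable low_density_of_mad[OF G mad] by blast
  thus thesis using that tone_coloring_of_partial by blast
qed

lemma mad_of_planar_girth:
  assumes G: "simple_graph V E" "V \<noteq> {}" and planar: "planar_graph V E" and girth: "12 \<le> girth V E"
  shows "mad V E < 12 / 5"
  unfolding mad_less_iff[OF G]
proof (intro allI impI)
  fix W F assume WF: "W \<subseteq> V \<and> W \<noteq> {} \<and> F \<subseteq> E \<and> simple_graph W F"
  obtain p \<gamma> where "plane_drawing V E p \<gamma>" using planar by (auto simp: planar_graph_def)
  hence drawing: "plane_drawing W F p \<gamma>"
    using plane_drawing_subgraph[of V E p \<gamma> W F] WF by (auto simp: simple_graph_def)
  have long: "12 \<le> card C" if C: "cycle_edges F C" for C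
  proof -
    have CE: "cycle_edges E C" using cycle_edges_mono[OF C] WF by blast
    then obtain x ys where xs: "distinct (x # ys)" "2 \<le> length ys" "C = path_edges (x # ys @ [x])" "C \<subseteq> E"
      by (auto simp: cycle_edges_def)
    have U: "\<Union>C = set (x # ys)" unfolding xs(3) by (subst Union_path_edges) auto
    have "\<Union>C \<subseteq> V" using xs(4) G(1) by (auto simp: simple_graph_def)
    \<comment> \<open>\<open>graph_cycle\<close> lists each vertex once and treats the closing edge
      separately, so the edge back to x is split off.\<close>
    obtain zs z where ys: "ys = zs @ [z]" using xs(2) by (cases ys rule: rev_cases) auto
    have "C = path_edges (x # ys) \<union> {{z, x}}"
      using path_edges_append[of "x # zs" z "[x]"] xs(3) ys by simp
    hence "path_edges (x # ys) \<subseteq> E" "{last (x # ys), hd (x # ys)} \<in> E" using xs(4) ys by auto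
    hence "graph_cycle V E (x # ys)"
      using xs(1,2) U \<open>\<Union>C \<subseteq> V\<close> unfolding graph_cycle_def graph_path_def successively_path_edges by auto
    hence "girth V E \<le> enat (length (x # ys))" unfolding girth_def by (intro INF_lower) simp
    hence "12 \<le> enat (length (x # ys))" by (rule order_trans[OF girth])
    hence "12 \<le> length (x # ys)" by (simp add: numeral_eq_enat)
    moreover have "card C = length (x # ys)"
      using card_cycle_vertices(1)[OF CE] U xs(1) by (metis distinct_card)
    ultimately show ?thesis by simp
  qed
  have "5 * card F + 6 \<le> 6 * card W"
    by (rule plane_graph_edge_bound[OF _ drawing _ long]) (use WF in auto)
  moreover have "0 < card W" using WF by (auto simp: simple_graph_def card_gt_0_iff)
  ultimately show "2 * real (card F) / real (card W) < 12 / 5" by (simp add: field_simps)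
qed

theorem theorem3p5:
  fixes V :: "'a set" and E :: "'a set set"
  assumes "simple_graph V E" and "V \<noteq> {}"
  shows "(mad V E < 12 / 5 \<longrightarrow>
            int (tone_chromatic_number 2 V E)
              \<le> max 7 \<lceil>sqrt (2 * real (max_degree V E) + 0.25) + 2.5\<rceil>) \<and>
         (planar_graph V E \<and> 12 \<le> girth V E \<and> 7 \<le> max_degree V E \<longrightarrow>
            int (tone_chromatic_number 2 V E)
              = \<lceil>sqrt (2 * real (max_degree V E) + 0.25) + 2.5\<rceil>)"
proof -
  let ?D = "max_degree V E" and ?t = "tone_chromatic_number 2 V E"
  let ?B = "\<lceil>sqrt (2 * real ?D + 0.25) + 2.5\<rceil>"
  let ?ok = "\<lambda>k. 0 < k \<and> (\<exists>f. tone_coloring 2 k V E f)"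
  \<comment> \<open>The least number of colors to which \<open>tone_coloring_exists\<close>
    applies.\<close>
  define k where "k = nat (max 7 ?B)"
  have k: "7 \<le> k" "int k = max 7 ?B" by (auto simp: k_def)
  have ok: "?ok k" if "mad V E < 12 / 5"
  proof -
    have "?D \<le> (k - 2) choose 2" using bound_le_iff[of k ?D] k by auto
    thus ?thesis using tone_coloring_exists[OF assms that k(1)] k(1) by (metis gr0I not_numeral_le_zero)
  qed
  have upper: "int ?t \<le> max 7 ?B" if "mad V E < 12 / 5"
    using Least_le[of ?ok, OF ok[OF that]] k(2) unfolding tone_chromatic_number_def by linarith
  moreover have "int ?t = ?B"
    if planar: "planar_graph V E" "12 \<le> girth V E" and D: "7 \<le> ?D"
  proof (rule antisym)
    have mad: "mad V E < 12 / 5" by (rule mad_of_planar_girth[OF assms planar])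
    \<comment> \<open>Six colors allow degree at most C(4,2) = 6, so here the bound is at least 7
      and the maximum with 7 is the bound itself.\<close>
    have "\<not> ?B \<le> 6"
      using bound_le_iff[of 6 ?D] D by (simp add: choose_two)
    thus "int ?t \<le> ?B" using upper[OF mad] by linarith
    obtain f where f: "tone_coloring 2 ?t V E f"
      using LeastI[of ?ok, OF ok[OF mad]] unfolding tone_chromatic_number_def by blast
    have "finite V" using assms(1) by (simp add: simple_graph_def)
    hence "?D \<in> degree E ` V" unfolding max_degree_def using assms(2) by (intro Max_in) auto
    then obtain v where v: "v \<in> V" "degree E v = ?D" by force
    have "?D \<le> (?t - 2) choose 2"
      using tone_coloring_degree_le[OF assms(1) f v(1)] v(2) by simp
    \<comment> \<open>For fewer than three colors truncated subtraction gives C(0,2) = 0, which is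
      less than 7.\<close>
    moreover from this have "3 \<le> ?t" using D by (cases "3 \<le> ?t") (auto simp: not_le binomial_eq_0)
    ultimately show "?B \<le> int ?t" using bound_le_iff by blast
  qed
  ultimately show ?thesis by blast
qed

end
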